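(* Let $G$ be a proper subgroup of $\mathbb{Q}$ and let $S_G$ be the set of primes $p$ such that $G$ is $p$-divisible. The Grothendieck ring $K_0(G;+,<)$ of the ordered abelian group $(G;+,<)$ is trivial (i.e. is the zero ring) in each of the following cases: \begin{itemize} \item $S_G$ contains only finitely many primes; \item there is some prime of the form $2^n+1$, $n\in\mathbb{N}$, that is not contained in $S_G$ (in other words, $2\notin S_G$ or some Fermat prime is not in $S_G$). \end{itemize}
   Context: $\mathbb{N}$ includes $0$, so that $2=2^0+1$ is of the form $2^n+1$. $G$ is $p$-divisible if for every $x\in G$ there is $y\in G$ with $p\cdot y=x$. The order on $G$ is the one induced from $\mathbb{Q}$. Grothendieck ring: for a first-order structure $\mathcal{M}$ with underlying set $M$, let $\mathrm{Def}(\mathcal{M})$ be the family of all subsets of $M^n$ ($n\geq 0$ arbitrary) definable in $\mathcal{M}$ with parameters. Two definable sets are definably isomorphic if there is a definable (with parameters) bijection between them. The Grothendieck group of $\mathcal{M}$ is the abelian group generated by symbols $[X]$, $X\in\mathrm{Def}(\mathcal{M})$, subject to the relations $[X]=[Y]$ whenever $X$ and $Y$ are definably isomorphic, and $[X\cup Y]=[X]+[Y]$ whenever $X\cap Y=\emptyset$. With the multiplication $[X][Y]=[X\times Y]$ it becomes a commutative ring, the Grothendieck ring $K_0(\mathcal{M})$. *)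

theory Defs
  imports
    Complex_Main
    "HOL-Library.Poly_Mapping"
    "HOL-Computational_Algebra.Primes"
    "HOL-Algebra.QuotRing"
    "HOL-Algebra.Generated_Groups"
begin

section \<open>First-order structures and definable sets\<close>

record ('f, 'r, 'a) fo_struct =
  universe :: "'a set"
  fun_arity :: "'f \<Rightarrow> nat"
  rel_arity :: "'r \<Rightarrow> nat"
  fun_interp :: "'f \<Rightarrow> 'a list \<Rightarrow> 'a"
  rel_interp :: "'r \<Rightarrow> 'a list \<Rightarrow> bool"

datatype 'f fo_term = Var nat | App 'f "'f fo_term list"

datatype ('f, 'r) fo_formula =
    Eq "'f fo_term" "'f fo_term"
  | Rel 'r "'f fo_term list"
  | Neg "('f, 'r) fo_formula"
  | Conj "('f, 'r) fo_formula" "('f, 'r) fo_formula"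
  | Exists nat "('f, 'r) fo_formula"

primrec wf_term :: "('f, 'r, 'a) fo_struct \<Rightarrow> 'f fo_term \<Rightarrow> bool" where
  "wf_term M (Var i) \<longleftrightarrow> True"
| "wf_term M (App f ts) \<longleftrightarrow> length ts = fun_arity M f \<and> list_all (wf_term M) ts"

primrec wf_formula :: "('f, 'r, 'a) fo_struct \<Rightarrow> ('f, 'r) fo_formula \<Rightarrow> bool" where
  "wf_formula M (Eq s t) \<longleftrightarrow> wf_term M s \<and> wf_term M t"
| "wf_formula M (Rel r ts) \<longleftrightarrow> length ts = rel_arity M r \<and> list_all (wf_term M) ts"
| "wf_formula M (Neg \<phi>) \<longleftrightarrow> wf_formula M \<phi>"
| "wf_formula M (Conj \<phi> \<psi>) \<longleftrightarrow> wf_formula M \<phi> \<and> wf_formula M \<psi>"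
| "wf_formula M (Exists i \<phi>) \<longleftrightarrow> wf_formula M \<phi>"

primrec eval_term :: "('f, 'r, 'a) fo_struct \<Rightarrow> (nat \<Rightarrow> 'a) \<Rightarrow> 'f fo_term \<Rightarrow> 'a" where
  "eval_term M e (Var i) = e i"
| "eval_term M e (App f ts) = fun_interp M f (map (eval_term M e) ts)"

primrec sat :: "('f, 'r, 'a) fo_struct \<Rightarrow> (nat \<Rightarrow> 'a) \<Rightarrow> ('f, 'r) fo_formula \<Rightarrow> bool" where
  "sat M e (Eq s t) \<longleftrightarrow> eval_term M e s = eval_term M e t"
| "sat M e (Rel r ts) \<longleftrightarrow> rel_interp M r (map (eval_term M e) ts)"
| "sat M e (Neg \<phi>) \<longleftrightarrow> \<not> sat M e \<phi>"
| "sat M e (Conj \<phi> \<psi>) \<longleftrightarrow> sat M e \<phi> \<and> sat M e \<psi>"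
| "sat M e (Exists i \<phi>) \<longleftrightarrow> (\<exists>a\<in>universe M. sat M (e(i := a)) \<phi>)"

text \<open>
  Points of \<open>M\<^sup>n\<close> are lists of length \<open>n\<close>. In the definition of a definable subset of \<open>M\<^sup>n\<close>,
  the variables \<open>0, \<dots>, n - 1\<close> stand for the coordinates of the point, and the variables
  from \<open>n\<close> on stand for parameters, whose values in \<open>M\<close> are given by \<open>e\<close>. Only the finitely many
  parameters occurring in the formula matter.
\<close>

definition definable_sets :: "('f, 'r, 'a) fo_struct \<Rightarrow> nat \<Rightarrow> 'a list set set" where
  "definable_sets M n =
     {{xs. length xs = n \<and> set xs \<subseteq> universe M \<and> sat M (\<lambda>i. if i < n then xs ! i else e i) \<phi>}
      | \<phi> e. wf_formula M \<phi> \<and> range e \<subseteq> universe M}"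

definition Def_sets :: "('f, 'r, 'a) fo_struct \<Rightarrow> 'a list set set" where
  "Def_sets M = (\<Union>n. definable_sets M n)"

definition definably_isomorphic ::
  "('f, 'r, 'a) fo_struct \<Rightarrow> 'a list set \<Rightarrow> 'a list set \<Rightarrow> bool" where
  "definably_isomorphic M X Y \<longleftrightarrow>
     (\<exists>m n f. X \<in> definable_sets M m \<and> Y \<in> definable_sets M n \<and> bij_betw f X Y \<and>
        {xs @ f xs | xs. xs \<in> X} \<in> definable_sets M (m + n))"

section \<open>The Grothendieck ring\<close>

definition list_times :: "'a list set \<Rightarrow> 'a list set \<Rightarrow> 'a list set" where
  "list_times X Y = {xs @ ys | xs ys. xs \<in> X \<and> ys \<in> Y}"

text \<open>
  The free abelian group on the symbols \<open>[X]\<close>, for \<open>X\<close> definable, with the biadditive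
  multiplication extending \<open>[X] [Y] = [X \<times> Y]\<close>; the unit is the class of the one-point
  set \<open>M\<^sup>0 = {[]}\<close>.
\<close>

definition free_def_ring :: "('f, 'r, 'a) fo_struct \<Rightarrow> ('a list set \<Rightarrow>\<^sub>0 int) ring" where
  "free_def_ring M =
     \<lparr>carrier = {c. Poly_Mapping.keys c \<subseteq> Def_sets M},
      mult = (\<lambda>c d. frag_extend (\<lambda>X. frag_extend (\<lambda>Y. frag_of (list_times X Y)) d) c),
      one = frag_of {[]},
      zero = 0,
      add = (+)\<rparr>"

definition grothendieck_relators :: "('f, 'r, 'a) fo_struct \<Rightarrow> ('a list set \<Rightarrow>\<^sub>0 int) set" where
  "grothendieck_relators M =
     {frag_of X - frag_of Y | X Y.
        X \<in> Def_sets M \<and> Y \<in> Def_sets M \<and> definably_isomorphic M X Y} \<union>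
     {frag_of (X \<union> Y) - (frag_of X + frag_of Y) | X Y n.
        X \<in> definable_sets M n \<and> Y \<in> definable_sets M n \<and> X \<inter> Y = {}}"

text \<open>
  The subgroup generated by the relators is a two-sided ideal, because multiplying a relator by
  a symbol \<open>[Z]\<close> on either side yields a relator again.
\<close>

definition Grothendieck_ring ::
  "('f, 'r, 'a) fo_struct \<Rightarrow> ('a list set \<Rightarrow>\<^sub>0 int) set ring" where
  "Grothendieck_ring M =
     free_def_ring M Quot generate (add_monoid (free_def_ring M)) (grothendieck_relators M)"

definition trivial_ring :: "('a, 'b) ring_scheme \<Rightarrow> bool" where
  "trivial_ring R \<longleftrightarrow> carrier R = {\<zero>\<^bsub>R\<^esub>}"

section \<open>Subgroups of the rationals as ordered groups\<close>

definition rat_group :: "rat monoid" where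
  "rat_group = \<lparr>carrier = UNIV, mult = (+), one = 0\<rparr>"

datatype og_fun = Plus
datatype og_rel = Less

text \<open>The structure \<open>(G; +, <)\<close>; both symbols are binary.\<close>

definition ordered_group_struct :: "rat set \<Rightarrow> (og_fun, og_rel, rat) fo_struct" where
  "ordered_group_struct G =
     \<lparr>universe = G,
      fun_arity = (\<lambda>_. 2),
      rel_arity = (\<lambda>_. 2),
      fun_interp = (\<lambda>_ xs. xs ! 0 + xs ! 1),
      rel_interp = (\<lambda>_ xs. xs ! 0 < xs ! 1)\<rparr>"

definition p_divisible :: "nat \<Rightarrow> rat set \<Rightarrow> bool" where
  "p_divisible p G \<longleftrightarrow> (\<forall>x\<in>G. \<exists>y\<in>G. of_nat p * y = x)"

definition divisible_primes :: "rat set \<Rightarrow> nat set" where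
  "divisible_primes G = {p. Factorial_Ring.prime p \<and> p_divisible p G}"

end

theory Submission
  imports Defs
begin

text \<open>
  Let \<open>a\<close> be the class of the set of positive elements of \<open>G\<close>. Cutting \<open>G\<close> at \<open>0\<close> gives
  \<open>[G] = 2 a + 1\<close>, and cutting the open quadrant along the diagonal gives \<open>a\<^sup>2 = 2 a\<^sup>2 + a\<close>, since both
  open octants are sheared images of the quadrant. Together these say \<open>[G]\<^sup>2 = 1\<close>
  (\<open>whole_square\<close>). In particular \<open>[G]\<close> is invertible, and every integer that annihilates \<open>[G]\<close> is
  zero in the Grothendieck ring.

  Now let \<open>p\<close> be a prime for which \<open>G\<close> is not \<open>p\<close>-divisible, and choose \<open>r\<close> outside \<open>p G\<close>. A
  subgroup of the rationals has at most \<open>p\<close> cosets modulo \<open>p G\<close>, so the cosets are those of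
  \<open>0, r, \<dots>, (p - 1) r\<close>. Multiplication by \<open>p\<close> and translation by \<open>j r\<close> map the half-line
  \<open>H\<^sub>j = {x. 0 < p x + j r}\<close> onto the positive part of the coset of \<open>j r\<close>. As \<open>H\<^sub>0\<close> is the set of all
  positive elements, adding up the cosets yields \<open>[H\<^sub>1] + \<dots> + [H\<^sub>p\<^sub>-\<^sub>1] = 0\<close>
  (\<open>half_line_sum\<close>). For \<open>0 < j < p\<close> the endpoint of \<open>H\<^sub>j\<close> is not in \<open>G\<close>; reflection and
  translation identify the complement of \<open>H\<^sub>j\<close> with \<open>H\<^sub>p\<^sub>-\<^sub>j\<close>, so
  \<open>[H\<^sub>j] + [H\<^sub>p\<^sub>-\<^sub>j] = [G]\<close>.

  For \<open>p = 2\<close> this means \<open>[H\<^sub>1] = 0\<close> and \<open>[G] = 2 [H\<^sub>1] = 0\<close>, and the ring is trivial. For odd \<open>p\<close> one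
  obtains \<open>((p - 1) / 2) [G] = 0\<close>, so the characteristic \<open>d\<close> of the ring is positive and divides
  \<open>(p - 1) / 2\<close> (\<open>half_of_predecessor_vanishes\<close>). If \<open>G\<close> is \<open>q\<close>-divisible for only finitely many
  primes \<open>q\<close>, almost all primes are thus \<open>1\<close> modulo \<open>2 d\<close>; Euclid's proof of the infinitude of primes, applied to numbers
  that are \<open>- 1\<close> modulo \<open>2 d\<close>, shows that this forces \<open>d = 1\<close>. If \<open>p = 2\<^sup>n + 1\<close> is odd and \<open>G\<close> is
  \<open>2\<close>-divisible, doubling is an automorphism of the ordered group that takes \<open>H\<^sub>1\<close> in \<open>n\<close> steps to
  \<open>H\<^sub>p\<^sub>-\<^sub>1\<close>. Then \<open>[G] = 2 [H\<^sub>1]\<close>, so \<open>2\<close> is invertible, whereas \<open>2\<^sup>n\<^sup>-\<^sup>1 = (p - 1) / 2\<close> is zero.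

  The formal development needs two preparations: definability of all the sets and bijections
  involved, and the fact that congruence modulo the relators is compatible with multiplication
  (\<open>K0_eq_times_class\<close>).
\<close>

section \<open>Definable predicates\<close>

definition tuples :: "('f, 'r, 'a) fo_struct \<Rightarrow> nat \<Rightarrow> 'a list set" where
  "tuples M n = {v. length v = n \<and> set v \<subseteq> universe M}"

text \<open>
  The values of the variables in the definition of a definable set: the coordinates of the point
  first, the parameters after them.
\<close>

definition assignment :: "nat \<Rightarrow> (nat \<Rightarrow> 'a) \<Rightarrow> 'a list \<Rightarrow> nat \<Rightarrow> 'a" where
  "assignment n e v = (\<lambda>i. if i < n then v ! i else e i)"

definition locus :: "('f, 'r, 'a) fo_struct \<Rightarrow> nat \<Rightarrow> ('a list \<Rightarrow> bool) \<Rightarrow> 'a list set" where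
  "locus M n P = {v \<in> tuples M n. P v}"

text \<open>
  Definable sets of dimension \<open>n\<close> are the loci of definable predicates. Predicates with the same
  extension on \<open>M\<^sup>n\<close> are interchangeable, so that definability can be proved by rules for the
  logical connectives, without writing down a formula.
\<close>

definition definable_pred :: "('f, 'r, 'a) fo_struct \<Rightarrow> nat \<Rightarrow> ('a list \<Rightarrow> bool) \<Rightarrow> bool" where
  "definable_pred M n P \<longleftrightarrow>
     (\<exists>\<phi> e. wf_formula M \<phi> \<and> range e \<subseteq> universe M \<and>
        (\<forall>v\<in>tuples M n. P v \<longleftrightarrow> sat M (assignment n e v) \<phi>))"

text \<open>
  The functions given by terms with parameters, the building blocks of the atomic predicates.
\<close>

definition term_function :: "('f, 'r, 'a) fo_struct \<Rightarrow> nat \<Rightarrow> ('a list \<Rightarrow> 'a) \<Rightarrow> bool" where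
  "term_function M n g \<longleftrightarrow>
     (\<exists>t e. wf_term M t \<and> range e \<subseteq> universe M \<and>
        (\<forall>v\<in>tuples M n. g v = eval_term M (assignment n e v) t))"

lemma locus_in_definable_sets_iff: "locus M n P \<in> definable_sets M n \<longleftrightarrow> definable_pred M n P"
proof
  assume "locus M n P \<in> definable_sets M n"
  then obtain \<phi> e where "wf_formula M \<phi>" "range e \<subseteq> universe M"
    and "locus M n P = {v. length v = n \<and> set v \<subseteq> universe M \<and>
           sat M (\<lambda>i. if i < n then v ! i else e i) \<phi>}"
    unfolding definable_sets_def by auto
  then show "definable_pred M n P"
    unfolding definable_pred_def
    by (intro exI[of _ \<phi>] exI[of _ e]) (auto simp: locus_def tuples_def assignment_def set_eq_iff)
next
  assume "definable_pred M n P"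
  then obtain \<phi> e where "wf_formula M \<phi>" "range e \<subseteq> universe M"
    and "\<forall>v\<in>tuples M n. P v \<longleftrightarrow> sat M (assignment n e v) \<phi>"
    unfolding definable_pred_def by auto
  then show "locus M n P \<in> definable_sets M n"
    unfolding definable_sets_def
    by (intro CollectI exI[of _ \<phi>] exI[of _ e]) (auto simp: locus_def tuples_def assignment_def)
qed

lemma definable_set_subset_tuples: "X \<in> definable_sets M n \<Longrightarrow> X \<subseteq> tuples M n"
  unfolding definable_sets_def tuples_def by auto

lemma definable_set_eq_locus: "X \<in> definable_sets M n \<Longrightarrow> X = locus M n (\<lambda>v. v \<in> X)"
  using definable_set_subset_tuples unfolding locus_def by blast

lemma definable_pred_mem: "X \<in> definable_sets M n \<Longrightarrow> definable_pred M n (\<lambda>v. v \<in> X)"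
  using definable_set_eq_locus locus_in_definable_sets_iff by metis

lemma definable_sets_nonempty_universe: "X \<in> definable_sets M n \<Longrightarrow> universe M \<noteq> {}"
  unfolding definable_sets_def by auto

lemma definable_sets_subset_Def_sets: "X \<in> definable_sets M n \<Longrightarrow> X \<in> Def_sets M"
  unfolding Def_sets_def by auto

lemma definable_pred_cong:
  assumes "definable_pred M n P" "\<And>v. v \<in> tuples M n \<Longrightarrow> P v \<longleftrightarrow> Q v"
  shows "definable_pred M n Q"
  using assms unfolding definable_pred_def by metis

primrec rename_term :: "(nat \<Rightarrow> nat) \<Rightarrow> 'f fo_term \<Rightarrow> 'f fo_term" where
  "rename_term \<sigma> (Var i) = Var (\<sigma> i)"
| "rename_term \<sigma> (App f ts) = App f (map (rename_term \<sigma>) ts)"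

primrec rename :: "(nat \<Rightarrow> nat) \<Rightarrow> ('f, 'r) fo_formula \<Rightarrow> ('f, 'r) fo_formula" where
  "rename \<sigma> (Eq s t) = Eq (rename_term \<sigma> s) (rename_term \<sigma> t)"
| "rename \<sigma> (Rel r ts) = Rel r (map (rename_term \<sigma>) ts)"
| "rename \<sigma> (Neg \<phi>) = Neg (rename \<sigma> \<phi>)"
| "rename \<sigma> (Conj \<phi> \<psi>) = Conj (rename \<sigma> \<phi>) (rename \<sigma> \<psi>)"
| "rename \<sigma> (Exists i \<phi>) = Exists (\<sigma> i) (rename \<sigma> \<phi>)"

lemma wf_rename_term [simp]: "wf_term M (rename_term \<sigma> t) \<longleftrightarrow> wf_term M t"
  by (induction t) (auto simp: list_all_iff)

lemma eval_rename_term [simp]: "eval_term M e (rename_term \<sigma> t) = eval_term M (e \<circ> \<sigma>) t"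
  by (induction t) (auto simp: comp_def intro!: arg_cong[of _ _ "fun_interp M _"])

lemma wf_rename [simp]: "wf_formula M (rename \<sigma> \<phi>) \<longleftrightarrow> wf_formula M \<phi>"
  by (induction \<phi>) (auto simp: list_all_iff)

text \<open>Injectivity keeps a renamed quantifier from capturing a renamed free variable.\<close>

lemma sat_rename: "inj \<sigma> \<Longrightarrow> sat M e (rename \<sigma> \<phi>) \<longleftrightarrow> sat M (e \<circ> \<sigma>) \<phi>"
proof (induction \<phi> arbitrary: e)
  case (Rel r ts)
  then show ?case by (simp add: comp_def)
next
  case (Exists i \<phi>)
  have upd: "(e(\<sigma> i := a)) \<circ> \<sigma> = (e \<circ> \<sigma>)(i := a)" for a
    using \<open>inj \<sigma>\<close> by (auto simp: fun_eq_iff inj_eq)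
  show ?case by (simp only: rename.simps sat.simps Exists.IH[OF Exists.prems] upd)
qed simp_all

text \<open>
  Two formulas come with two parameter assignments. Moving the parameters of one formula to the
  positions of one parity and those of the other formula to the positions of the other parity
  makes a single assignment serve both; the variables for the coordinates may be moved on
  the way, as long as they stay distinct.
\<close>

definition spread :: "nat \<Rightarrow> (nat \<Rightarrow> nat) \<Rightarrow> nat \<Rightarrow> nat \<Rightarrow> nat \<Rightarrow> nat" where
  "spread m \<tau> N b i = (if i < m then \<tau> i else N + 2 * (i - m) + b)"

definition interleave :: "nat \<Rightarrow> nat \<Rightarrow> (nat \<Rightarrow> 'a) \<Rightarrow> nat \<Rightarrow> (nat \<Rightarrow> 'a) \<Rightarrow> nat \<Rightarrow> 'a" where
  "interleave N m e n e' k = (if even (k - N) then e (m + (k - N) div 2) else e' (n + (k - N) div 2))"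

lemma inj_spread:
  assumes "inj_on \<tau> {..<m}" "\<tau> ` {..<m} \<subseteq> {..<N}"
  shows "inj (spread m \<tau> N b)"
proof (rule injI)
  fix i j assume "spread m \<tau> N b i = spread m \<tau> N b j"
  moreover have "k < m \<Longrightarrow> \<tau> k < N" for k using assms(2) by auto
  ultimately show "i = j"
    using assms(1) by (force simp: spread_def inj_on_def split: if_splits)
qed

lemma assignment_interleave:
  assumes "\<tau> ` {..<m} \<subseteq> {..<N}"
  shows "assignment N (interleave N m e n e') v \<circ> spread m \<tau> N 0 =
           assignment m e (map (\<lambda>i. v ! \<tau> i) [0..<m])"
    and "assignment N (interleave N n e' m e) v \<circ> spread m \<tau> N 1 =
           assignment m e (map (\<lambda>i. v ! \<tau> i) [0..<m])"
  using assms by (auto simp: fun_eq_iff assignment_def interleave_def spread_def image_subset_iff)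

lemma range_interleave:
  "range e \<subseteq> A \<Longrightarrow> range e' \<subseteq> A \<Longrightarrow> range (interleave N m e n e') \<subseteq> A"
  by (auto simp: interleave_def)

lemma reindex_tuples:
  assumes "\<tau> ` {..<m} \<subseteq> {..<N}" "v \<in> tuples M N"
  shows "map (\<lambda>i. v ! \<tau> i) [0..<m] \<in> tuples M m"
proof -
  have "v ! \<tau> i \<in> universe M" if "i < m" for i
    using assms that unfolding tuples_def by (auto simp: image_subset_iff intro!: subsetD[OF _ nth_mem])
  then show ?thesis by (auto simp: tuples_def)
qed

lemma definable_pred_reindex:
  assumes "definable_pred M m P" "inj_on \<tau> {..<m}" "\<tau> ` {..<m} \<subseteq> {..<N}"
  shows "definable_pred M N (\<lambda>v. P (map (\<lambda>i. v ! \<tau> i) [0..<m]))"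
proof -
  obtain \<phi> e where "wf_formula M \<phi>" "range e \<subseteq> universe M"
    and P: "\<forall>v\<in>tuples M m. P v \<longleftrightarrow> sat M (assignment m e v) \<phi>"
    using assms(1) unfolding definable_pred_def by auto
  moreover have "range (interleave N m e m e) \<subseteq> universe M"
    using calculation(2) by (rule range_interleave) fact
  moreover have "sat M (assignment N (interleave N m e m e) v) (rename (spread m \<tau> N 0) \<phi>)
      \<longleftrightarrow> P (map (\<lambda>i. v ! \<tau> i) [0..<m])" if "v \<in> tuples M N" for v
    using P reindex_tuples[OF assms(3) that]
    by (simp add: sat_rename inj_spread assms assignment_interleave)
  ultimately show ?thesis
    unfolding definable_pred_def by (metis wf_rename)
qed

lemma map_nth_tuple: "v \<in> tuples M n \<Longrightarrow> map (\<lambda>i. v ! i) [0..<n] = v"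
  by (auto simp: tuples_def map_nth)

lemma definable_pred_not: "definable_pred M n P \<Longrightarrow> definable_pred M n (\<lambda>v. \<not> P v)"
  unfolding definable_pred_def by (metis sat.simps(3) wf_formula.simps(3))

lemma definable_pred_conj:
  assumes "definable_pred M n P" "definable_pred M n Q"
  shows "definable_pred M n (\<lambda>v. P v \<and> Q v)"
proof -
  obtain \<phi> e where \<phi>: "wf_formula M \<phi>" "range e \<subseteq> universe M"
    "\<forall>v\<in>tuples M n. P v \<longleftrightarrow> sat M (assignment n e v) \<phi>"
    using assms(1) unfolding definable_pred_def by auto
  obtain \<psi> e' where \<psi>: "wf_formula M \<psi>" "range e' \<subseteq> universe M"
    "\<forall>v\<in>tuples M n. Q v \<longleftrightarrow> sat M (assignment n e' v) \<psi>"
    using assms(2) unfolding definable_pred_def by auto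
  let ?e = "interleave n n e n e'"
  let ?\<chi> = "Conj (rename (spread n (\<lambda>i. i) n 0) \<phi>) (rename (spread n (\<lambda>i. i) n 1) \<psi>)"
  have "wf_formula M ?\<chi>" "range ?e \<subseteq> universe M"
    using \<phi> \<psi> by (simp_all add: range_interleave)
  moreover have "(P v \<and> Q v) \<longleftrightarrow> sat M (assignment n ?e v) ?\<chi>" if "v \<in> tuples M n" for v
    using \<phi>(3) \<psi>(3) that
    by (simp add: sat_rename inj_spread assignment_interleave map_nth_tuple[OF that] del: One_nat_def)
  ultimately show ?thesis unfolding definable_pred_def by blast
qed

lemma definable_pred_disj:
  assumes "definable_pred M n P" "definable_pred M n Q"
  shows "definable_pred M n (\<lambda>v. P v \<or> Q v)"
  using definable_pred_not[OF definable_pred_conj[OF assms[THEN definable_pred_not]]] by simp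

text \<open>
  The quantified variable becomes the coordinate number \<open>n\<close>, which is the last one of the longer
  tuple. The parameters of the longer tuple start at \<open>n + 1\<close> and keep their places.
\<close>

lemma definable_pred_ex:
  assumes "definable_pred M (Suc n) P"
  shows "definable_pred M n (\<lambda>v. \<exists>a\<in>universe M. P (v @ [a]))"
proof -
  obtain \<phi> e where \<phi>: "wf_formula M \<phi>" "range e \<subseteq> universe M"
    "\<forall>v\<in>tuples M (Suc n). P v \<longleftrightarrow> sat M (assignment (Suc n) e v) \<phi>"
    using assms(1) unfolding definable_pred_def by auto
  have "(\<exists>a\<in>universe M. P (v @ [a])) \<longleftrightarrow> sat M (assignment n e v) (Exists n \<phi>)"
    if "v \<in> tuples M n" for v
  proof -
    have "(assignment n e v)(n := a) = assignment (Suc n) e (v @ [a])" for a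
      using that by (auto simp: fun_eq_iff assignment_def tuples_def nth_append)
    moreover have "v @ [a] \<in> tuples M (Suc n)" if "a \<in> universe M" for a
      using that \<open>v \<in> tuples M n\<close> by (auto simp: tuples_def)
    ultimately show ?thesis using \<phi>(3) by auto
  qed
  with \<phi>(1,2) show ?thesis unfolding definable_pred_def by (metis wf_formula.simps(5))
qed

lemma term_function_nth: "universe M \<noteq> {} \<Longrightarrow> i < n \<Longrightarrow> term_function M n (\<lambda>v. v ! i)"
  unfolding term_function_def
  by (rule exI[of _ "Var i"], rule exI[of _ "\<lambda>_. SOME a. a \<in> universe M"])
     (auto simp: assignment_def some_in_eq)

lemma term_function_const: "c \<in> universe M \<Longrightarrow> term_function M n (\<lambda>_. c)"
  unfolding term_function_def
  by (rule exI[of _ "Var n"], rule exI[of _ "\<lambda>_. c"]) (auto simp: assignment_def)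

lemma common_parameters:
  assumes "term_function M n g" "term_function M n h"
  obtains s t e where "wf_term M s" "wf_term M t" "range e \<subseteq> universe M"
    "\<And>v. v \<in> tuples M n \<Longrightarrow> g v = eval_term M (assignment n e v) s"
    "\<And>v. v \<in> tuples M n \<Longrightarrow> h v = eval_term M (assignment n e v) t"
proof -
  obtain s e where s: "wf_term M s" "range e \<subseteq> universe M"
    "\<forall>v\<in>tuples M n. g v = eval_term M (assignment n e v) s"
    using assms(1) unfolding term_function_def by auto
  obtain t e' where t: "wf_term M t" "range e' \<subseteq> universe M"
    "\<forall>v\<in>tuples M n. h v = eval_term M (assignment n e' v) t"
    using assms(2) unfolding term_function_def by auto
  show thesis
  proof (rule that)
    show "wf_term M (rename_term (spread n (\<lambda>i. i) n 0) s)"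
      "wf_term M (rename_term (spread n (\<lambda>i. i) n 1) t)"
      "range (interleave n n e n e') \<subseteq> universe M"
      using s t by (simp_all add: range_interleave)
  qed (use s t in \<open>simp_all add: assignment_interleave map_nth_tuple del: One_nat_def\<close>)
qed

lemma definable_pred_eq:
  assumes "term_function M n g" "term_function M n h"
  shows "definable_pred M n (\<lambda>v. g v = h v)"
  using assms
proof (rule common_parameters)
  fix s t e assume "wf_term M s" "wf_term M t" "range e \<subseteq> universe M"
    "\<And>v. v \<in> tuples M n \<Longrightarrow> g v = eval_term M (assignment n e v) s"
    "\<And>v. v \<in> tuples M n \<Longrightarrow> h v = eval_term M (assignment n e v) t"
  then show ?thesis unfolding definable_pred_def by (intro exI[of _ "Eq s t"] exI[of _ e]) auto
qed

lemma definable_pred_True: "universe M \<noteq> {} \<Longrightarrow> definable_pred M n (\<lambda>_. True)"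
  using definable_pred_eq[OF term_function_const term_function_const] by (fastforce simp: ex_in_conv[symmetric])

lemma definable_pred_all_less:
  fixes k :: nat
  assumes "universe M \<noteq> {}" "\<And>i. i < k \<Longrightarrow> definable_pred M n (P i)"
  shows "definable_pred M n (\<lambda>v. \<forall>i<k. P i v)"
proof -
  have "j \<le> k \<Longrightarrow> definable_pred M n (\<lambda>v. \<forall>i<j. P i v)" for j
  proof (induction j)
    case 0
    then show ?case using assms(1) by (simp add: definable_pred_True)
  next
    case (Suc j)
    then have "definable_pred M n (\<lambda>v. (\<forall>i<j. P i v) \<and> P j v)"
      using assms(2) by (intro definable_pred_conj) auto
    then show ?case by (rule definable_pred_cong) (auto simp: less_Suc_eq)
  qed
  then show ?thesis by blast
qed

text \<open>
  The special case of reindexing used for products and graphs: the predicate is evaluated at two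
  disjoint segments of a long tuple.
\<close>

lemma definable_pred_two_blocks:
  assumes "definable_pred M (m + k) P" "a + m \<le> b" "b + k \<le> N"
  shows "definable_pred M N (\<lambda>v. P (take m (drop a v) @ take k (drop b v)))"
proof -
  define \<tau> where "\<tau> i = (if i < m then a + i else b + (i - m))" for i
  have "inj_on \<tau> {..<m + k}" "\<tau> ` {..<m + k} \<subseteq> {..<N}"
    using assms(2,3) by (auto simp: inj_on_def \<tau>_def split: if_splits)
  note definable = definable_pred_reindex[OF assms(1) this]
  have "map (\<lambda>i. v ! \<tau> i) [0..<m + k] = take m (drop a v) @ take k (drop b v)"
    if "v \<in> tuples M N" for v
    using that assms(2,3) by (intro nth_equalityI) (auto simp: tuples_def \<tau>_def nth_append)
  with definable show ?thesis by (auto elim: definable_pred_cong)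
qed

lemma definable_pred_block:
  assumes "definable_pred M m P" "a + m \<le> N"
  shows "definable_pred M N (\<lambda>v. P (take m (drop a v)))"
  using definable_pred_two_blocks[of M m 0 P a "a + m" N] assms by simp

lemma definable_pred_block_eq:
  assumes "universe M \<noteq> {}" "a + m \<le> N" "b + m \<le> N"
  shows "definable_pred M N (\<lambda>v. take m (drop a v) = take m (drop b v))"
proof -
  have "definable_pred M N (\<lambda>v. \<forall>i<m. v ! (a + i) = v ! (b + i))"
    using assms by (intro definable_pred_all_less definable_pred_eq term_function_nth) auto
  then show ?thesis
    by (rule definable_pred_cong) (use assms(2,3) in \<open>auto simp: tuples_def list_eq_iff_nth_eq\<close>)
qed

section \<open>Congruence modulo the relators\<close>

definition relator_subgroup :: "('f, 'r, 'a) fo_struct \<Rightarrow> ('a list set \<Rightarrow>\<^sub>0 int) set" where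
  "relator_subgroup M = generate (add_monoid (free_def_ring M)) (grothendieck_relators M)"

text \<open>
  Two elements of the free group are congruent when they have the same class in the Grothendieck
  ring. All computations in that ring are carried out with representatives.
\<close>

definition K0_eq ::
  "('f, 'r, 'a) fo_struct \<Rightarrow> ('a list set \<Rightarrow>\<^sub>0 int) \<Rightarrow> ('a list set \<Rightarrow>\<^sub>0 int) \<Rightarrow> bool" where
  "K0_eq M c d \<longleftrightarrow> c - d \<in> relator_subgroup M"

text \<open>
  Multiplication by the generator \<open>[X]\<close> of the free ring.
\<close>

definition times_class ::
  "'a list set \<Rightarrow> ('a list set \<Rightarrow>\<^sub>0 int) \<Rightarrow> ('a list set \<Rightarrow>\<^sub>0 int)" where
  "times_class X = frag_extend (\<lambda>Y. frag_of (list_times X Y))"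

lemma group_add_free_def_ring: "group (add_monoid (free_def_ring M))"
proof (rule groupI)
  fix x y assume "x \<in> carrier (add_monoid (free_def_ring M))" "y \<in> carrier (add_monoid (free_def_ring M))"
  then show "x \<otimes>\<^bsub>add_monoid (free_def_ring M)\<^esub> y \<in> carrier (add_monoid (free_def_ring M))"
    using keys_add[of x y] by (auto simp: free_def_ring_def)
next
  fix x assume "x \<in> carrier (add_monoid (free_def_ring M))"
  then show "\<exists>y\<in>carrier (add_monoid (free_def_ring M)).
      y \<otimes>\<^bsub>add_monoid (free_def_ring M)\<^esub> x = \<one>\<^bsub>add_monoid (free_def_ring M)\<^esub>"
    by (intro bexI[of _ "- x"]) (auto simp: free_def_ring_def)
qed (auto simp: free_def_ring_def add.assoc)

lemma definable_sets_union:
  assumes "X \<in> definable_sets M n" "Y \<in> definable_sets M n"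
  shows "X \<union> Y \<in> definable_sets M n"
proof -
  have "X \<union> Y = locus M n (\<lambda>v. v \<in> X \<or> v \<in> Y)"
    using assms[THEN definable_set_subset_tuples] by (auto simp: locus_def)
  then show ?thesis
    using assms by (simp add: locus_in_definable_sets_iff definable_pred_disj definable_pred_mem)
qed

lemma relators_subset_carrier: "grothendieck_relators M \<subseteq> carrier (add_monoid (free_def_ring M))"
proof
  have singles: "frag_of X - frag_of Y \<in> carrier (free_def_ring M)"
    if "X \<in> Def_sets M" "Y \<in> Def_sets M" for X Y
    using that keys_diff[of "frag_of X" "frag_of Y"] by (auto simp: free_def_ring_def)
  fix r assume "r \<in> grothendieck_relators M"
  then consider X Y where "r = frag_of X - frag_of Y" "X \<in> Def_sets M" "Y \<in> Def_sets M"
    | X Y n where "r = (frag_of (X \<union> Y) - frag_of X) - frag_of Y"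
        "X \<in> definable_sets M n" "Y \<in> definable_sets M n"
    unfolding grothendieck_relators_def by (auto simp: algebra_simps)
  then show "r \<in> carrier (add_monoid (free_def_ring M))"
  proof cases
    case 2
    then have "frag_of (X \<union> Y) - frag_of X \<in> carrier (free_def_ring M)" "Y \<in> Def_sets M"
      by (auto intro!: singles definable_sets_union definable_sets_subset_Def_sets)
    then show ?thesis
      using keys_diff[of "frag_of (X \<union> Y) - frag_of X" "frag_of Y"] 2
      by (auto simp: free_def_ring_def)
  qed (use singles in auto)
qed

lemma inv_add_free_def_ring:
  assumes "c \<in> carrier (free_def_ring M)"
  shows "inv\<^bsub>add_monoid (free_def_ring M)\<^esub> c = - c"
proof -
  interpret group "add_monoid (free_def_ring M)" by (rule group_add_free_def_ring)
  show ?thesis using assms by (intro inv_equality) (auto simp: free_def_ring_def)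
qed

lemma relator_subgroup_relator: "r \<in> grothendieck_relators M \<Longrightarrow> r \<in> relator_subgroup M"
  unfolding relator_subgroup_def by (rule generate.incl)

lemma relator_subgroup_zero [simp]: "0 \<in> relator_subgroup M"
  using generate.one[of "add_monoid (free_def_ring M)"]
  by (simp add: relator_subgroup_def free_def_ring_def)

lemma relator_subgroup_add:
  "c \<in> relator_subgroup M \<Longrightarrow> d \<in> relator_subgroup M \<Longrightarrow> c + d \<in> relator_subgroup M"
  using generate.eng[of c "add_monoid (free_def_ring M)" "grothendieck_relators M" d]
  by (simp add: relator_subgroup_def free_def_ring_def)

lemma relator_subgroup_uminus:
  assumes "c \<in> relator_subgroup M"
  shows "- c \<in> relator_subgroup M"
proof -
  interpret group "add_monoid (free_def_ring M)" by (rule group_add_free_def_ring)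
  have "c \<in> carrier (free_def_ring M)"
    using generate_incl[OF relators_subset_carrier] assms unfolding relator_subgroup_def by auto
  from inv_add_free_def_ring[OF this] show ?thesis
    using generate_m_inv_closed[OF relators_subset_carrier] assms
    unfolding relator_subgroup_def by metis
qed

lemma relator_subgroup_diff:
  "c \<in> relator_subgroup M \<Longrightarrow> d \<in> relator_subgroup M \<Longrightarrow> c - d \<in> relator_subgroup M"
  using relator_subgroup_add[of c M "- d"] relator_subgroup_uminus[of d M] by simp

lemma relator_subgroup_cmul: "c \<in> relator_subgroup M \<Longrightarrow> frag_cmul k c \<in> relator_subgroup M"
  by (rule frag_closure_minus_cmul) (auto intro: relator_subgroup_diff)

lemma K0_eq_refl [simp]: "K0_eq M c c"
  by (simp add: K0_eq_def)

lemma K0_eq_sym: "K0_eq M c d \<Longrightarrow> K0_eq M d c"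
  unfolding K0_eq_def by (metis relator_subgroup_uminus minus_diff_eq)

lemma K0_eq_trans [trans]: "K0_eq M c d \<Longrightarrow> K0_eq M d e \<Longrightarrow> K0_eq M c e"
  unfolding K0_eq_def using relator_subgroup_add[of "c - d" M "d - e"] by simp

lemma K0_eq_add: "K0_eq M c d \<Longrightarrow> K0_eq M c' d' \<Longrightarrow> K0_eq M (c + c') (d + d')"
  unfolding K0_eq_def using relator_subgroup_add[of "c - d" M "c' - d'"] by (simp add: algebra_simps)

lemma K0_eq_diff: "K0_eq M c d \<Longrightarrow> K0_eq M c' d' \<Longrightarrow> K0_eq M (c - c') (d - d')"
  unfolding K0_eq_def using relator_subgroup_diff[of "c - d" M "c' - d'"] by (simp add: algebra_simps)

lemma K0_eq_cancel: "K0_eq M c (c + d) \<Longrightarrow> K0_eq M d 0"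
  unfolding K0_eq_def using relator_subgroup_uminus[of "c - (c + d)" M] by simp

lemma frag_cmul_diff: "frag_cmul k (c - d) = frag_cmul k c - frag_cmul k d"
  by (rule poly_mapping_eqI) (simp add: lookup_minus algebra_simps)

lemma K0_eq_cmul: "K0_eq M c d \<Longrightarrow> K0_eq M (frag_cmul k c) (frag_cmul k d)"
  unfolding K0_eq_def using relator_subgroup_cmul[of "c - d" M k] by (simp add: frag_cmul_diff)

lemma K0_eq_sum: "(\<And>i. i \<in> I \<Longrightarrow> K0_eq M (c i) (d i)) \<Longrightarrow> K0_eq M (sum c I) (sum d I)"
  by (induction I rule: infinite_finite_induct) (auto intro: K0_eq_add)

text \<open>
  The graph of \<open>f\<close> only has to be described on \<open>X \<times> Y\<close>: membership in \<open>X\<close> and \<open>Y\<close> is definable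
  anyway, so \<open>R\<close> may be a simple equation such as \<open>x + y = 0\<close>.
\<close>

lemma K0_eq_iso:
  assumes X: "X \<in> definable_sets M m" and Y: "Y \<in> definable_sets M n" and "bij_betw f X Y"
    and R: "definable_pred M (m + n) R"
    and graph: "\<And>x y. x \<in> X \<Longrightarrow> y \<in> Y \<Longrightarrow> R (x @ y) \<longleftrightarrow> y = f x"
  shows "K0_eq M (frag_of X) (frag_of Y)"
proof -
  let ?P = "\<lambda>v. take m (drop 0 v) \<in> X \<and> take n (drop m v) \<in> Y \<and> R v"
  have len: "x \<in> X \<Longrightarrow> x \<in> tuples M m" "y \<in> Y \<Longrightarrow> y \<in> tuples M n" for x y
    using X Y definable_set_subset_tuples by blast+
  have fY: "x \<in> X \<Longrightarrow> f x \<in> Y" for x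
    using assms(3) by (auto simp: bij_betw_def)
  have "definable_pred M (m + n) ?P"
    using X Y R by (intro definable_pred_conj definable_pred_block definable_pred_mem) auto
  moreover have "{x @ f x | x. x \<in> X} = locus M (m + n) ?P"
  proof (intro Set.set_eqI iffI)
    fix v assume "v \<in> {x @ f x | x. x \<in> X}"
    then obtain x where "v = x @ f x" "x \<in> X" by blast
    then show "v \<in> locus M (m + n) ?P"
      using len(1)[of x] len(2)[of "f x"] fY[of x] graph[of x "f x"] by (auto simp: locus_def tuples_def)
  next
    fix v assume v: "v \<in> locus M (m + n) ?P"
    then have "v = take m v @ take n (drop m v)"
      by (auto simp: locus_def tuples_def)
    then show "v \<in> {x @ f x | x. x \<in> X}"
      using v graph[of "take m v" "take n (drop m v)"]
      by (auto simp: locus_def intro!: exI[of _ "take m v"])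
  qed
  ultimately have "{x @ f x | x. x \<in> X} \<in> definable_sets M (m + n)"
    by (simp only: locus_in_definable_sets_iff)
  then have "definably_isomorphic M X Y"
    unfolding definably_isomorphic_def using assms(1-3) by blast
  then have "frag_of X - frag_of Y \<in> grothendieck_relators M"
    unfolding grothendieck_relators_def using X Y definable_sets_subset_Def_sets by blast
  then show ?thesis by (simp add: K0_eq_def relator_subgroup_relator)
qed

lemma K0_eq_union:
  assumes "X \<in> definable_sets M n" "Y \<in> definable_sets M n" "X \<inter> Y = {}"
  shows "K0_eq M (frag_of (X \<union> Y)) (frag_of X + frag_of Y)"
  unfolding K0_eq_def
  by (rule relator_subgroup_relator) (use assms in \<open>auto simp: grothendieck_relators_def\<close>)

lemma definable_sets_empty: "universe M \<noteq> {} \<Longrightarrow> {} \<in> definable_sets M n"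
  using definable_pred_not[OF definable_pred_True, of M n] locus_in_definable_sets_iff[of M n "\<lambda>_. False"]
  by (simp add: locus_def)

text \<open>
  The empty set is the disjoint union of two copies of itself.
\<close>

lemma K0_eq_empty: "universe M \<noteq> {} \<Longrightarrow> K0_eq M (frag_of {}) 0"
  using K0_eq_union[of "{}" M 0 "{}"] definable_sets_empty[of M 0]
  by (auto simp: K0_eq_def dest: relator_subgroup_uminus)

lemma K0_eq_UNION:
  fixes k :: nat
  assumes "universe M \<noteq> {}" "\<And>j. j < k \<Longrightarrow> X j \<in> definable_sets M n"
    and "\<And>i j. i < j \<Longrightarrow> j < k \<Longrightarrow> X i \<inter> X j = {}"
  shows "K0_eq M (frag_of (\<Union>j<k. X j)) (\<Sum>j<k. frag_of (X j))"
proof -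
  have "(\<Union>j<l. X j) \<in> definable_sets M n \<and>
      K0_eq M (frag_of (\<Union>j<l. X j)) (\<Sum>j<l. frag_of (X j))" if "l \<le> k" for l
    using that
  proof (induction l)
    case 0
    then show ?case using assms(1) by (simp add: definable_sets_empty K0_eq_empty)
  next
    case (Suc l)
    have union: "(\<Union>j<Suc l. X j) = (\<Union>j<l. X j) \<union> X l"
      by (auto simp: less_Suc_eq)
    have "(\<Union>j<l. X j) \<inter> X l = {}"
      using assms(3) Suc.prems by fastforce
    then have "K0_eq M (frag_of (\<Union>j<Suc l. X j)) (frag_of (\<Union>j<l. X j) + frag_of (X l))"
      unfolding union using Suc assms(2) by (intro K0_eq_union) auto
    moreover have "K0_eq M (frag_of (\<Union>j<l. X j) + frag_of (X l)) (\<Sum>j<Suc l. frag_of (X j))"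
      using Suc by (auto intro!: K0_eq_add)
    ultimately have "K0_eq M (frag_of (\<Union>j<Suc l. X j)) (\<Sum>j<Suc l. frag_of (X j))"
      by (rule K0_eq_trans)
    then show ?case
      unfolding union using Suc assms(2) by (simp add: definable_sets_union)
  qed
  then show ?thesis by blast
qed

section \<open>Multiplication by a class\<close>

lemma list_times_eq_locus:
  assumes "X \<in> definable_sets M m" "Y \<in> definable_sets M n"
  shows "list_times X Y = locus M (m + n) (\<lambda>v. take m (drop 0 v) \<in> X \<and> take n (drop m v) \<in> Y)"
proof -
  have X: "x \<in> X \<Longrightarrow> x \<in> tuples M m" and Y: "y \<in> Y \<Longrightarrow> y \<in> tuples M n" for x y
    using assms definable_set_subset_tuples by blast+
  show ?thesis
  proof (intro Set.set_eqI iffI)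
    fix v assume "v \<in> locus M (m + n) (\<lambda>v. take m (drop 0 v) \<in> X \<and> take n (drop m v) \<in> Y)"
    then show "v \<in> list_times X Y"
      unfolding list_times_def locus_def tuples_def
      by (intro CollectI exI[of _ "take m v"] exI[of _ "drop m v"]) auto
  next
    fix v assume "v \<in> list_times X Y"
    then obtain x y where "v = x @ y" "x \<in> X" "y \<in> Y" unfolding list_times_def by blast
    then show "v \<in> locus M (m + n) (\<lambda>v. take m (drop 0 v) \<in> X \<and> take n (drop m v) \<in> Y)"
      using X[of x] Y[of y] by (simp add: locus_def tuples_def)
  qed
qed

lemma definable_sets_list_times:
  assumes "X \<in> definable_sets M m" "Y \<in> definable_sets M n"
  shows "list_times X Y \<in> definable_sets M (m + n)"
  unfolding list_times_eq_locus[OF assms] locus_in_definable_sets_iff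
  using assms by (intro definable_pred_conj definable_pred_block definable_pred_mem) auto

lemma times_class_of [simp]: "times_class X (frag_of Y) = frag_of (list_times X Y)"
  by (simp add: times_class_def)

lemma times_class_0 [simp]: "times_class X 0 = 0"
  by (simp add: times_class_def)

lemma times_class_add: "times_class X (c + d) = times_class X c + times_class X d"
  by (simp add: times_class_def frag_extend_add)

lemma times_class_diff: "times_class X (c - d) = times_class X c - times_class X d"
  by (simp add: times_class_def frag_extend_diff)

lemma times_class_cmul: "times_class X (frag_cmul k c) = frag_cmul k (times_class X c)"
  by (simp add: times_class_def frag_extend_cmul)

text \<open>
  If \<open>f\<close> is a definable bijection, so is \<open>id \<times> f\<close>. Its graph consists of the tuples \<open>z x z' y\<close> with
  \<open>z = z'\<close> and \<open>x y\<close> in the graph of \<open>f\<close>, which explains the block positions below.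
\<close>

lemma times_class_iso_relator:
  assumes Z: "Z \<in> definable_sets M n" and "definably_isomorphic M X Y"
  shows "K0_eq M (frag_of (list_times Z X)) (frag_of (list_times Z Y))"
proof -
  obtain k l f where X: "X \<in> definable_sets M k" and Y: "Y \<in> definable_sets M l"
    and f: "bij_betw f X Y" and F: "{x @ f x | x. x \<in> X} \<in> definable_sets M (k + l)" (is "?F \<in> _")
    using assms(2) unfolding definably_isomorphic_def by blast
  have U: "universe M \<noteq> {}" using Z by (rule definable_sets_nonempty_universe)
  have lenZ: "z \<in> Z \<Longrightarrow> length z = n" and lenX: "x \<in> X \<Longrightarrow> length x = k"
    and lenY: "y \<in> Y \<Longrightarrow> length y = l" for z x y
    using X Y Z definable_set_subset_tuples by (fastforce simp: tuples_def)+
  have fY: "x \<in> X \<Longrightarrow> f x \<in> Y" for x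
    using f by (auto simp: bij_betw_def)
  let ?g = "\<lambda>v. take n v @ f (drop n v)"
  let ?R = "\<lambda>v. take n (drop 0 v) = take n (drop (n + k) v) \<and>
                take k (drop n v) @ take l (drop (n + k + n) v) \<in> ?F"
  show ?thesis
  proof (rule K0_eq_iso)
    show "list_times Z X \<in> definable_sets M (n + k)" "list_times Z Y \<in> definable_sets M (n + l)"
      using X Y Z by (simp_all add: definable_sets_list_times)
    show "bij_betw ?g (list_times Z X) (list_times Z Y)"
    proof (rule bij_betw_byWitness[where f' = "\<lambda>v. take n v @ inv_into X f (drop n v)"])
      show "\<forall>v\<in>list_times Z X. take n (?g v) @ inv_into X f (drop n (?g v)) = v"
        using f lenZ by (auto simp: list_times_def bij_betw_inv_into_left)
      show "\<forall>v\<in>list_times Z Y. ?g (take n v @ inv_into X f (drop n v)) = v"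
        using f lenZ by (auto simp: list_times_def bij_betw_inv_into_right)
      show "?g ` list_times Z X \<subseteq> list_times Z Y"
        using fY lenZ by (fastforce simp: list_times_def)
      have "inv_into X f y \<in> X" if "y \<in> Y" for y
        using f that by (auto simp: bij_betw_def intro: inv_into_into)
      then show "(\<lambda>v. take n v @ inv_into X f (drop n v)) ` list_times Z Y \<subseteq> list_times Z X"
        using lenZ by (fastforce simp: list_times_def)
    qed
    show "definable_pred M ((n + k) + (n + l)) ?R"
      using U F by (intro definable_pred_conj definable_pred_block_eq definable_pred_two_blocks
          definable_pred_mem) auto
    fix v w assume "v \<in> list_times Z X" "w \<in> list_times Z Y"
    then obtain z x z' y where v: "v = z @ x" "z \<in> Z" "x \<in> X" and w: "w = z' @ y" "z' \<in> Z" "y \<in> Y"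
      unfolding list_times_def by blast
    have "x @ y \<in> ?F \<longleftrightarrow> y = f x"
      using v w lenX by (auto simp: append_eq_append_conv)
    then show "?R (v @ w) \<longleftrightarrow> w = ?g v"
      using v w lenX lenY lenZ by auto
  qed
qed

lemma times_class_union_relator:
  assumes Z: "Z \<in> definable_sets M k" and XY: "X \<in> definable_sets M n" "Y \<in> definable_sets M n"
    and "X \<inter> Y = {}"
  shows "K0_eq M (frag_of (list_times Z (X \<union> Y))) (frag_of (list_times Z X) + frag_of (list_times Z Y))"
proof -
  have "list_times Z (X \<union> Y) = list_times Z X \<union> list_times Z Y"
    by (auto simp: list_times_def)
  moreover have "list_times Z X \<inter> list_times Z Y = {}"
  proof -
    have "length z = k" if "z \<in> Z" for z
      using Z that definable_set_subset_tuples by (fastforce simp: tuples_def)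
    then show ?thesis using assms(4) by (fastforce simp: list_times_def append_eq_append_conv)
  qed
  ultimately show ?thesis
    using K0_eq_union[of _ M "k + n"] assms(1-3) by (simp add: definable_sets_list_times)
qed

text \<open>
  Multiplication by \<open>[Z]\<close> is additive and sends relators into the relator subgroup, hence it
  respects congruence: the relator subgroup is closed under multiplication by generators.
\<close>

lemma K0_eq_times_class:
  assumes "K0_eq M c d" "Z \<in> definable_sets M n"
  shows "K0_eq M (times_class Z c) (times_class Z d)"
proof -
  have relator: "times_class Z r \<in> relator_subgroup M" if "r \<in> grothendieck_relators M" for r
    using that times_class_iso_relator[OF assms(2)] times_class_union_relator[OF assms(2)]
    by (auto simp: grothendieck_relators_def times_class_diff times_class_add K0_eq_def)
  have "times_class Z c \<in> relator_subgroup M"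
    if "c \<in> generate (add_monoid (free_def_ring M)) (grothendieck_relators M)" for c
    using that
  proof (induction rule: generate.induct)
    case one
    then show ?case by (simp add: free_def_ring_def)
  next
    case (incl h)
    then show ?case by (rule relator)
  next
    case (inv h)
    then have "inv\<^bsub>add_monoid (free_def_ring M)\<^esub> h = - h"
      using relators_subset_carrier by (intro inv_add_free_def_ring) auto
    then show ?case
      using relator[OF inv] relator_subgroup_uminus times_class_diff[of Z 0 h] by simp
  next
    case (eng c d)
    then show ?case
      by (simp add: free_def_ring_def times_class_add relator_subgroup_add)
  qed
  then show ?thesis using assms(1) by (simp add: K0_eq_def relator_subgroup_def times_class_diff[symmetric])
qed

text \<open>
  Exchanging the two factors is a definable bijection. Its graph consists of the tuples
  \<open>x y y' x'\<close> with \<open>x = x'\<close> and \<open>y = y'\<close>.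
\<close>

lemma K0_eq_times_commute:
  assumes X: "X \<in> definable_sets M m" and Y: "Y \<in> definable_sets M n"
  shows "K0_eq M (frag_of (list_times X Y)) (frag_of (list_times Y X))"
proof (rule K0_eq_iso)
  have U: "universe M \<noteq> {}" using X by (rule definable_sets_nonempty_universe)
  have lenX: "x \<in> X \<Longrightarrow> length x = m" and lenY: "y \<in> Y \<Longrightarrow> length y = n" for x y
    using X Y definable_set_subset_tuples by (fastforce simp: tuples_def)+
  show "list_times X Y \<in> definable_sets M (m + n)" "list_times Y X \<in> definable_sets M (n + m)"
    using X Y by (simp_all add: definable_sets_list_times)
  show "bij_betw (\<lambda>v. drop m v @ take m v) (list_times X Y) (list_times Y X)"
  proof (rule bij_betw_byWitness[where f' = "\<lambda>v. drop n v @ take n v"])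
    show "(\<lambda>v. drop m v @ take m v) ` list_times X Y \<subseteq> list_times Y X"
      "(\<lambda>v. drop n v @ take n v) ` list_times Y X \<subseteq> list_times X Y"
      using lenX lenY by (fastforce simp: list_times_def)+
  qed (auto simp: list_times_def lenX lenY)
  let ?R = "\<lambda>v. take m (drop 0 v) = take m (drop (m + n + n) v) \<and>
                take n (drop m v) = take n (drop (m + n) v)"
  show "definable_pred M ((m + n) + (n + m)) ?R"
    using U by (intro definable_pred_conj definable_pred_block_eq) auto
  fix v w assume "v \<in> list_times X Y" "w \<in> list_times Y X"
  then obtain x y x' y' where "v = x @ y" "w = y' @ x'" "x \<in> X" "y \<in> Y" "x' \<in> X" "y' \<in> Y"
    unfolding list_times_def by blast
  then show "?R (v @ w) \<longleftrightarrow> w = drop m v @ take m v"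
    by (auto simp: lenX lenY)
qed

lemma list_times_unit [simp]: "list_times {[]} X = X" "list_times X {[]} = X"
  by (auto simp: list_times_def)

text \<open>
  The one-point set \<open>M\<^sup>0\<close> is the unit, so \<open>[X] = [X] [M\<^sup>0] = 0\<close> for all \<open>X\<close> as soon as
  \<open>[M\<^sup>0] = 0\<close>, and these classes generate the ring.
\<close>

lemma trivial_ring_if_unit_vanishes:
  assumes "K0_eq M (frag_of {[]}) 0"
  shows "trivial_ring (Grothendieck_ring M)"
proof -
  let ?F = "free_def_ring M" and ?I = "relator_subgroup M"
  have all: "c \<in> ?I" if "c \<in> carrier ?F" for c
  proof -
    have "Poly_Mapping.keys c \<subseteq> Def_sets M"
      using that by (simp add: free_def_ring_def)
    then show ?thesis
    proof (induction rule: frag_induction)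
      case (one X)
      then obtain n where "X \<in> definable_sets M n" by (auto simp: Def_sets_def)
      from K0_eq_times_class[OF assms this] show ?case by (simp add: K0_eq_def)
    qed (auto intro: relator_subgroup_diff)
  qed
  have "?I +>\<^bsub>?F\<^esub> c = ?I" if "c \<in> carrier ?F" for c
  proof -
    have "?I +>\<^bsub>?F\<^esub> c = (\<lambda>d. d + c) ` ?I"
      by (auto simp: a_r_coset_def' free_def_ring_def)
    also have "\<dots> = ?I"
    proof
      show "(\<lambda>d. d + c) ` ?I \<subseteq> ?I"
        using all[OF that] by (auto intro: relator_subgroup_add)
      show "?I \<subseteq> (\<lambda>d. d + c) ` ?I"
      proof
        fix d assume "d \<in> ?I"
        then have "d - c \<in> ?I" using all[OF that] by (rule relator_subgroup_diff)
        then show "d \<in> (\<lambda>d. d + c) ` ?I" by (rule rev_image_eqI) simp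
      qed
    qed
    finally show ?thesis .
  qed
  moreover have "0 \<in> carrier ?F" by (simp add: free_def_ring_def)
  ultimately have "a_rcosets\<^bsub>?F\<^esub> ?I = {?I}"
    unfolding A_RCOSETS_def' by blast
  then show ?thesis
    by (simp add: trivial_ring_def Grothendieck_ring_def FactRing_def relator_subgroup_def)
qed

section \<open>Subgroups of the rationals\<close>

locale rat_subgroup =
  fixes G :: "rat set"
  assumes zero_mem: "0 \<in> G"
    and add_mem: "x \<in> G \<Longrightarrow> y \<in> G \<Longrightarrow> x + y \<in> G"
    and uminus_mem: "x \<in> G \<Longrightarrow> - x \<in> G"
begin

lemma diff_mem: "x \<in> G \<Longrightarrow> y \<in> G \<Longrightarrow> x - y \<in> G"
  using add_mem[of x "- y"] uminus_mem[of y] by simp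

lemma of_nat_mult_mem: "x \<in> G \<Longrightarrow> of_nat k * x \<in> G"
  by (induction k) (auto simp: algebra_simps intro: zero_mem add_mem)

lemma of_int_mult_mem: "x \<in> G \<Longrightarrow> of_int k * x \<in> G"
  by (cases k rule: int_cases2) (auto intro: of_nat_mult_mem uminus_mem)

text \<open>
  If \<open>a k + b p = 1\<close>, then \<open>r = a (k r) + p (b r)\<close> lies in \<open>p G\<close> whenever \<open>k r\<close> does.
\<close>

lemma divides_if_coprime_multiple:
  fixes p k :: int
  assumes "coprime k p" "p \<noteq> 0" "r \<in> G" "y \<in> G" "of_int p * y = of_int k * r"
  shows "\<exists>z\<in>G. of_int p * z = r"
proof -
  obtain a b where "a * k + b * p = 1"
    using assms(1) bezout_int[of k p] by auto
  have "of_int p * (of_int a * y + of_int b * r) = of_int a * (of_int p * y) + of_int b * of_int p * r"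
    by (simp add: algebra_simps)
  also have "\<dots> = of_int (a * k + b * p) * r"
    unfolding assms(5) by (simp add: algebra_simps)
  finally have "of_int p * (of_int a * y + of_int b * r) = r"
    using \<open>a * k + b * p = 1\<close> by simp
  then show ?thesis
    using assms(3,4) by (blast intro: add_mem of_int_mult_mem)
qed

text \<open>
  Finitely generated subgroups of the rationals are cyclic: over a common denominator, the greatest
  common divisor of the numerators is a generator.
\<close>

lemma common_generator:
  assumes "x \<in> G" "y \<in> G"
  obtains t k l where "t \<in> G" "x = of_int k * t" "y = of_int l * t"
proof -
  obtain a b where x: "x = of_int a / of_int b" "b > 0"
    by (metis Rat_cases Fract_of_int_quotient)
  obtain c d where y: "y = of_int c / of_int d" "d > 0"
    by (metis Rat_cases Fract_of_int_quotient)
  define g where "g = gcd (a * d) (c * b)"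
  define t :: rat where "t = of_int g / of_int (b * d)"
  obtain k l where kl: "a * d = g * k" "c * b = g * l"
    unfolding g_def by (meson dvdE gcd_dvd1 gcd_dvd2)
  obtain u v where "u * (a * d) + v * (c * b) = g"
    using bezout_int[of "a * d" "c * b"] unfolding g_def by auto
  moreover have "of_int u * x + of_int v * y = of_int (u * (a * d) + v * (c * b)) / of_int (b * d)"
    using x(2) y(2) unfolding x(1) y(1) by (simp add: field_simps)
  ultimately have "t = of_int u * x + of_int v * y"
    unfolding t_def by simp
  moreover have "x = of_int k * t" "y = of_int l * t"
    using x(2) y(2) kl unfolding t_def x(1) y(1)
    by (simp_all add: field_simps flip: of_int_mult)
  ultimately show thesis
    using that assms by (metis add_mem of_int_mult_mem)
qed

text \<open>
  The multiples \<open>0, r, \<dots>, (p - 1) r\<close> represent all cosets of \<open>p G\<close>: writing \<open>r = k t\<close> and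
  \<open>x = l t\<close>, the number \<open>k\<close> is invertible modulo \<open>p\<close>, because \<open>r\<close> is not divisible by \<open>p\<close>, and
  \<open>j = l k\<^sup>-\<^sup>1\<close> modulo \<open>p\<close> does the job.
\<close>

lemma cosets_exhaust:
  fixes p :: nat
  assumes p: "Factorial_Ring.prime p" and r: "r \<in> G" "\<And>y. y \<in> G \<Longrightarrow> of_nat p * y \<noteq> r" and x: "x \<in> G"
  shows "\<exists>j<p. \<exists>y\<in>G. x = of_nat p * y + of_nat j * r"
proof -
  obtain t k l where t: "t \<in> G" "r = of_int k * t" "x = of_int l * t"
    using common_generator[OF r(1) x] by blast
  have "\<not> int p dvd k"
  proof
    assume "int p dvd k"
    then obtain k' where "k = int p * k'" by (rule dvdE)
    then have "of_nat p * (of_int k' * t) = r" using t by simp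
    then show False using r(2) t(1) of_int_mult_mem by blast
  qed
  moreover have "Factorial_Ring.prime (int p)" using p by simp
  ultimately have "coprime k (int p)"
    by (metis coprime_commute prime_imp_coprime)
  then obtain a b where ab: "a * k + b * int p = 1"
    using bezout_int[of k "int p"] by auto
  define j where "j = nat ((a * l) mod int p)"
  have "p > 0" using p by (rule prime_gt_0_nat)
  then have j: "int j = (a * l) mod int p" "j < p"
    unfolding j_def by (simp_all add: nat_less_iff)
  have "l - int j * k = l * (a * k + b * int p) - int j * k" using ab by simp
  also have "\<dots> = k * (a * l - (a * l) mod int p) + int p * (b * l)"
    unfolding j(1) by (simp add: algebra_simps)
  also have "\<dots> = int p * (k * (a * l div int p) + b * l)"
    by (simp add: minus_mod_eq_mult_div algebra_simps)
  finally obtain w where "l = int p * w + int j * k"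
    by (metis diff_eq_eq)
  then have "x = of_nat p * (of_int w * t) + of_nat j * r"
    unfolding t(2,3) by (simp add: algebra_simps)
  then show ?thesis using j(2) of_int_mult_mem[OF t(1)] by blast
qed

section \<open>Definable sets in an ordered group of rationals\<close>

abbreviation "\<M> \<equiv> ordered_group_struct G"

lemma universe_ordered_group [simp]: "universe \<M> = G"
  by (simp add: ordered_group_struct_def)

lemma universe_nonempty: "universe \<M> \<noteq> {}"
  using zero_mem by auto

lemma term_function_add:
  assumes "term_function \<M> n g" "term_function \<M> n h"
  shows "term_function \<M> n (\<lambda>v. g v + h v)"
  using assms
proof (rule common_parameters)
  fix s t e assume "wf_term \<M> s" "wf_term \<M> t" "range e \<subseteq> universe \<M>"
    "\<And>v. v \<in> tuples \<M> n \<Longrightarrow> g v = eval_term \<M> (assignment n e v) s"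
    "\<And>v. v \<in> tuples \<M> n \<Longrightarrow> h v = eval_term \<M> (assignment n e v) t"
  then show ?thesis
    unfolding term_function_def
    by (intro exI[of _ "App Plus [s, t]"] exI[of _ e]) (auto simp: ordered_group_struct_def)
qed

lemma term_function_of_nat_mult:
  "term_function \<M> n g \<Longrightarrow> term_function \<M> n (\<lambda>v. of_nat k * g v)"
proof (induction k)
  case 0
  then show ?case using term_function_const[of 0 \<M>] zero_mem by simp
next
  case (Suc k)
  then show ?case using term_function_add[of n g "\<lambda>v. of_nat k * g v"] by (simp add: algebra_simps)
qed

lemma definable_pred_less:
  assumes "term_function \<M> n g" "term_function \<M> n h"
  shows "definable_pred \<M> n (\<lambda>v. g v < h v)"
  using assms
proof (rule common_parameters)
  fix s t e assume "wf_term \<M> s" "wf_term \<M> t" "range e \<subseteq> universe \<M>"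
    "\<And>v. v \<in> tuples \<M> n \<Longrightarrow> g v = eval_term \<M> (assignment n e v) s"
    "\<And>v. v \<in> tuples \<M> n \<Longrightarrow> h v = eval_term \<M> (assignment n e v) t"
  then show ?thesis
    unfolding definable_pred_def
    by (intro exI[of _ "Rel Less [s, t]"] exI[of _ e]) (auto simp: ordered_group_struct_def)
qed

lemma term_function_coordinate: "i < n \<Longrightarrow> term_function \<M> n (\<lambda>v. v ! i)"
  using universe_nonempty by (rule term_function_nth)

lemma term_function_parameter: "c \<in> G \<Longrightarrow> term_function \<M> n (\<lambda>_. c)"
  by (rule term_function_const) simp

lemmas definable_intros = definable_pred_conj definable_pred_eq definable_pred_less
  definable_pred_True[OF universe_nonempty] term_function_add term_function_of_nat_mult
  term_function_coordinate term_function_parameter zero_mem uminus_mem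

lemma tuples_1: "v \<in> tuples \<M> 1 \<longleftrightarrow> (\<exists>x\<in>G. v = [x])"
  by (auto simp: tuples_def length_Suc_conv)

lemma tuples_2: "v \<in> tuples \<M> 2 \<longleftrightarrow> (\<exists>x\<in>G. \<exists>y\<in>G. v = [x, y])"
  by (auto simp: tuples_def length_Suc_conv numeral_2_eq_2)

definition line :: "(rat \<Rightarrow> bool) \<Rightarrow> rat list set" where
  "line P = locus \<M> 1 (\<lambda>v. P (v ! 0))"

definition plane :: "(rat \<Rightarrow> rat \<Rightarrow> bool) \<Rightarrow> rat list set" where
  "plane P = locus \<M> 2 (\<lambda>v. P (v ! 0) (v ! 1))"

lemma line_eq: "line P = {[x] | x. x \<in> G \<and> P x}"
  unfolding line_def locus_def tuples_1 by auto

lemma plane_eq: "plane P = {[x, y] | x y. x \<in> G \<and> y \<in> G \<and> P x y}"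
  unfolding plane_def locus_def tuples_2 by auto

lemma definable_line: "definable_pred \<M> 1 (\<lambda>v. P (v ! 0)) \<Longrightarrow> line P \<in> definable_sets \<M> 1"
  unfolding line_def by (simp only: locus_in_definable_sets_iff)

lemma definable_plane:
  "definable_pred \<M> 2 (\<lambda>v. P (v ! 0) (v ! 1)) \<Longrightarrow> plane P \<in> definable_sets \<M> 2"
  unfolding plane_def by (simp only: locus_in_definable_sets_iff)

lemma definable_unit: "{[]} \<in> definable_sets \<M> 0"
  using definable_pred_True[OF universe_nonempty, of 0] locus_in_definable_sets_iff[of \<M> 0 "\<lambda>_. True"]
  by (simp add: locus_def tuples_def cong: conj_cong)

text \<open>
  In applications \<open>R\<close> is an equation without subtraction and division, since terms are
  sums of variables and parameters.
\<close>

lemma K0_eq_line_iso: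
  assumes "line P \<in> definable_sets \<M> 1" "line Q \<in> definable_sets \<M> 1"
    and R: "definable_pred \<M> 2 (\<lambda>v. R (v ! 0) (v ! 1))"
    and h: "\<And>x. x \<in> G \<Longrightarrow> P x \<Longrightarrow> h x \<in> G \<and> Q (h x) \<and> k (h x) = x"
    and k: "\<And>y. y \<in> G \<Longrightarrow> Q y \<Longrightarrow> k y \<in> G \<and> P (k y) \<and> h (k y) = y"
    and graph: "\<And>x y. x \<in> G \<Longrightarrow> y \<in> G \<Longrightarrow> P x \<Longrightarrow> Q y \<Longrightarrow> R x y \<longleftrightarrow> y = h x"
  shows "K0_eq \<M> (frag_of (line P)) (frag_of (line Q))"
proof (rule K0_eq_iso[OF assms(1,2)])
  show "bij_betw (\<lambda>v. [h (v ! 0)]) (line P) (line Q)"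
    by (rule bij_betw_byWitness[where f' = "\<lambda>v. [k (v ! 0)]"]) (use h k in \<open>auto simp: line_eq\<close>)
  show "definable_pred \<M> (1 + 1) (\<lambda>v. R (v ! 0) (v ! 1))"
    using R by (simp only: one_add_one)
qed (use graph in \<open>auto simp: line_eq\<close>)

lemma K0_eq_line_union:
  assumes "line P \<in> definable_sets \<M> 1" "line Q \<in> definable_sets \<M> 1"
    and "\<And>x. x \<in> G \<Longrightarrow> A x \<longleftrightarrow> P x \<or> Q x" "\<And>x. x \<in> G \<Longrightarrow> \<not> (P x \<and> Q x)"
  shows "K0_eq \<M> (frag_of (line A)) (frag_of (line P) + frag_of (line Q))"
proof -
  have "line A = line P \<union> line Q" "line P \<inter> line Q = {}"
    using assms(3,4) by (auto simp: line_eq)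
  with K0_eq_union[OF assms(1,2)] show ?thesis by simp
qed

lemma list_times_line: "list_times (line P) (line Q) = plane (\<lambda>x y. P x \<and> Q y)"
proof
  show "plane (\<lambda>x y. P x \<and> Q y) \<subseteq> list_times (line P) (line Q)"
  proof
    fix v assume "v \<in> plane (\<lambda>x y. P x \<and> Q y)"
    then obtain x y where "v = [x] @ [y]" "[x] \<in> line P" "[y] \<in> line Q"
      by (auto simp: plane_eq line_eq)
    then show "v \<in> list_times (line P) (line Q)" unfolding list_times_def by blast
  qed
qed (auto simp: list_times_def line_eq plane_eq)

abbreviation "whole \<equiv> line (\<lambda>_. True)"
abbreviation "positives \<equiv> line (\<lambda>x. 0 < x)"

lemma definable_whole: "whole \<in> definable_sets \<M> 1"
  by (intro definable_line definable_intros)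

lemma definable_positives: "positives \<in> definable_sets \<M> 1"
  by (intro definable_line definable_intros) auto

section \<open>The square of the class of the group is the unit\<close>

text \<open>
  Let \<open>a\<close> be the class of the positive elements. The diagonal cuts the open quadrant into a copy of
  the positive elements and two open octants, and shearing maps the quadrant onto either octant.
  Therefore \<open>a\<^sup>2 = 2 a\<^sup>2 + a\<close>, that is \<open>a\<^sup>2 + a = 0\<close>.
\<close>

lemma quadrant_class:
  "K0_eq \<M> (frag_of (list_times positives positives) + frag_of positives) 0"
proof -
  let ?Q = "plane (\<lambda>x y. 0 < x \<and> 0 < y)"
  let ?L = "plane (\<lambda>x y. 0 < x \<and> x < y)"
  let ?D = "plane (\<lambda>x y. 0 < x \<and> x = y)"
  let ?U = "plane (\<lambda>x y. 0 < y \<and> y < x)"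
  have def: "?Q \<in> definable_sets \<M> 2" "?L \<in> definable_sets \<M> 2"
    "?D \<in> definable_sets \<M> 2" "?U \<in> definable_sets \<M> 2"
    by (intro definable_plane definable_intros; simp)+
  \<comment> \<open>the two shears\<close>
  have L: "K0_eq \<M> (frag_of ?Q) (frag_of ?L)"
  proof (rule K0_eq_iso[OF def(1,2)])
    show "bij_betw (\<lambda>v. [v ! 0, v ! 0 + v ! 1]) ?Q ?L"
      by (rule bij_betw_byWitness[where f' = "\<lambda>v. [v ! 0, v ! 1 - v ! 0]"])
         (auto simp: plane_eq intro: add_mem diff_mem)
    show "definable_pred \<M> (2 + 2) (\<lambda>v. v ! 2 = v ! 0 \<and> v ! 3 = v ! 0 + v ! 1)"
      by (intro definable_intros) auto
  qed (auto simp: plane_eq)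
  have U: "K0_eq \<M> (frag_of ?Q) (frag_of ?U)"
  proof (rule K0_eq_iso[OF def(1,4)])
    show "bij_betw (\<lambda>v. [v ! 0 + v ! 1, v ! 0]) ?Q ?U"
      by (rule bij_betw_byWitness[where f' = "\<lambda>v. [v ! 1, v ! 0 - v ! 1]"])
         (auto simp: plane_eq intro: add_mem diff_mem)
    show "definable_pred \<M> (2 + 2) (\<lambda>v. v ! 2 = v ! 0 + v ! 1 \<and> v ! 3 = v ! 0)"
      by (intro definable_intros) auto
  qed (auto simp: plane_eq)
  have D: "K0_eq \<M> (frag_of positives) (frag_of ?D)"
  proof (rule K0_eq_iso[OF definable_positives def(3)])
    show "bij_betw (\<lambda>v. [v ! 0, v ! 0]) positives ?D"
      by (rule bij_betw_byWitness[where f' = "\<lambda>v. [v ! 0]"]) (auto simp: plane_eq line_eq)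
    show "definable_pred \<M> (1 + 2) (\<lambda>v. v ! 1 = v ! 0 \<and> v ! 2 = v ! 0)"
      by (intro definable_intros) auto
  qed (auto simp: plane_eq line_eq)
  have "K0_eq \<M> (frag_of (?L \<union> (?D \<union> ?U))) (frag_of ?L + frag_of (?D \<union> ?U))"
    by (intro K0_eq_union[where n = 2] definable_sets_union def) (auto simp: plane_eq)
  also have "K0_eq \<M> \<dots> (frag_of ?L + (frag_of ?D + frag_of ?U))"
    by (intro K0_eq_add K0_eq_refl K0_eq_union[where n = 2] def) (auto simp: plane_eq)
  also have "K0_eq \<M> \<dots> (frag_of ?Q + (frag_of positives + frag_of ?Q))"
    by (intro K0_eq_add K0_eq_sym[OF L] K0_eq_sym[OF D] K0_eq_sym[OF U])
  also have "?L \<union> (?D \<union> ?U) = ?Q"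
    by (auto simp: plane_eq)
  finally have "K0_eq \<M> (frag_of ?Q) (frag_of ?Q + (frag_of positives + frag_of ?Q))" .
  then have "K0_eq \<M> (frag_of ?Q + frag_of positives) 0"
    using K0_eq_cancel by (simp add: add.commute)
  moreover have "list_times positives positives = ?Q"
    by (rule list_times_line)
  ultimately show ?thesis by simp
qed

text \<open>
  Negation is definable, so that \<open>[G] = 2 a + 1\<close>.
\<close>

lemma whole_class:
  "K0_eq \<M> (frag_of whole) (frag_of positives + (frag_of {[]} + frag_of positives))"
proof -
  let ?Z = "line (\<lambda>x. x = 0)" and ?N = "line (\<lambda>x. x < 0)"
  have def: "?Z \<in> definable_sets \<M> 1" "?N \<in> definable_sets \<M> 1" "line (\<lambda>x. \<not> 0 < x) \<in> definable_sets \<M> 1"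
    by (intro definable_line definable_intros definable_pred_not; simp)+
  have "K0_eq \<M> (frag_of whole) (frag_of positives + frag_of (line (\<lambda>x. \<not> 0 < x)))"
    using definable_positives def by (intro K0_eq_line_union) auto
  also have "K0_eq \<M> \<dots> (frag_of positives + (frag_of ?Z + frag_of ?N))"
    using def by (intro K0_eq_add K0_eq_refl K0_eq_line_union) auto
  also have "K0_eq \<M> \<dots> (frag_of positives + (frag_of {[]} + frag_of positives))"
  proof (intro K0_eq_add K0_eq_refl)
    show "K0_eq \<M> (frag_of ?Z) (frag_of {[]})"
    proof (rule K0_eq_iso[OF def(1) definable_unit])
      show "bij_betw (\<lambda>_. []) ?Z {[]}"
        using zero_mem by (auto simp: line_eq bij_betw_def)
      show "definable_pred \<M> (1 + 0) (\<lambda>_. True)"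
        by (intro definable_intros)
    qed auto
    show "K0_eq \<M> (frag_of ?N) (frag_of positives)"
    proof (rule K0_eq_line_iso[where R = "\<lambda>x y. x + y = 0" and h = uminus and k = uminus, OF def(2) definable_positives])
      show "definable_pred \<M> 2 (\<lambda>v. v ! 0 + v ! 1 = 0)"
        by (intro definable_intros) auto
    qed (auto intro: uminus_mem)
  qed
  finally show ?thesis .
qed

text \<open>
  From \<open>[G] = 2 a + 1\<close> and \<open>a\<^sup>2 = - a\<close> one gets \<open>[G] a = 2 a\<^sup>2 + a = - a\<close> and hence
  \<open>[G]\<^sup>2 = 2 [G] a + [G] = - 2 a + (2 a + 1) = 1\<close>.
\<close>

lemma whole_square: "K0_eq \<M> (frag_of (list_times whole whole)) (frag_of {[]})"
proof -
  let ?a = "frag_of positives" and ?g = "frag_of whole" and ?u = "frag_of {[] :: rat list}"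
  let ?q = "frag_of (list_times positives positives)"
  have "K0_eq \<M> (frag_of (list_times whole positives)) (frag_of (list_times positives whole))"
    by (rule K0_eq_times_commute[OF definable_whole definable_positives])
  also have "K0_eq \<M> \<dots> (?q + (?a + ?q))"
    using K0_eq_times_class[OF whole_class definable_positives] by (simp add: times_class_add)
  also have "K0_eq \<M> \<dots> (- ?a)"
    using relator_subgroup_add[of "?q + ?a" \<M> "?q + ?a"] quadrant_class
    by (simp add: K0_eq_def algebra_simps)
  finally have strip: "K0_eq \<M> (frag_of (list_times whole positives)) (- ?a)" .
  have "K0_eq \<M> (frag_of (list_times whole whole))
      (frag_of (list_times whole positives) + (?g + frag_of (list_times whole positives)))"
    using K0_eq_times_class[OF whole_class definable_whole] by (simp add: times_class_add)
  also have "K0_eq \<M> \<dots> (- ?a + ((?a + (?u + ?a)) + - ?a))"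
    by (intro K0_eq_add strip whole_class)
  finally show ?thesis by simp
qed

text \<open>
  Multiply by \<open>[G]\<close>, which is its own inverse.
\<close>

lemma unit_torsion:
  assumes "K0_eq \<M> (frag_cmul k (frag_of whole)) 0"
  shows "K0_eq \<M> (frag_cmul k (frag_of {[]})) 0"
proof -
  have "K0_eq \<M> (frag_cmul k (frag_of {[]})) (frag_cmul k (frag_of (list_times whole whole)))"
    by (intro K0_eq_cmul K0_eq_sym[OF whole_square])
  also have "K0_eq \<M> \<dots> 0"
    using K0_eq_times_class[OF assms definable_whole] by (simp add: times_class_cmul)
  finally show ?thesis .
qed

section \<open>Half-lines with endpoint outside the group\<close>

text \<open>
  The half-line starting at \<open>- c / p\<close>. This endpoint lies in \<open>G\<close> only if \<open>c\<close> lies in \<open>p G\<close>; the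
  definition by an inequality in \<open>p x\<close> makes sense without division.
\<close>

definition half_line :: "nat \<Rightarrow> rat \<Rightarrow> rat list set" where
  "half_line p c = line (\<lambda>x. 0 < of_nat p * x + c)"

lemma definable_half_line: "c \<in> G \<Longrightarrow> half_line p c \<in> definable_sets \<M> 1"
  unfolding half_line_def by (intro definable_line definable_intros) auto

text \<open>
  Translation by an element of \<open>G\<close>: only the endpoint modulo \<open>G\<close> matters, that is, \<open>c\<close> modulo
  \<open>p G\<close>.
\<close>

lemma half_line_translate:
  assumes "c \<in> G" "g \<in> G"
  shows "K0_eq \<M> (frag_of (half_line p c)) (frag_of (half_line p (c + of_nat p * g)))"
  unfolding half_line_def
proof (rule K0_eq_line_iso[where R = "\<lambda>x y. x = y + g" and h = "\<lambda>x. x - g" and k = "\<lambda>y. y + g"])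
  show "definable_pred \<M> 2 (\<lambda>v. v ! 0 = v ! 1 + g)"
    using assms by (intro definable_intros) auto
  have "c + of_nat p * g \<in> G" using assms by (intro add_mem of_nat_mult_mem)
  then show "line (\<lambda>x. 0 < of_nat p * x + c) \<in> definable_sets \<M> 1"
    "line (\<lambda>x. 0 < of_nat p * x + (c + of_nat p * g)) \<in> definable_sets \<M> 1"
    using assms definable_half_line unfolding half_line_def by blast+
  fix x assume "x \<in> G" "0 < of_nat p * x + c"
  then show "x - g \<in> G \<and> 0 < of_nat p * (x - g) + (c + of_nat p * g) \<and> (x - g) + g = x"
    using assms by (simp add: diff_mem algebra_simps)
next
  fix y assume "y \<in> G" "0 < of_nat p * y + (c + of_nat p * g)"
  then show "y + g \<in> G \<and> 0 < of_nat p * (y + g) + c \<and> (y + g) - g = y"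
    using assms by (simp add: add_mem algebra_simps)
qed auto

text \<open>
  As the endpoint \<open>- c / p\<close> is outside \<open>G\<close>, the complement of the half-line is the open half-line
  in the other direction, and negation turns it around.
\<close>

lemma half_line_complement:
  assumes c: "c \<in> G" "\<And>y. y \<in> G \<Longrightarrow> of_nat p * y \<noteq> c"
  shows "K0_eq \<M> (frag_of whole) (frag_of (half_line p c) + frag_of (half_line p (- c)))"
proof -
  let ?N = "line (\<lambda>x. of_nat p * x + c < 0)"
  have N: "?N \<in> definable_sets \<M> 1"
    using c by (intro definable_line definable_intros) auto
  have "0 < of_nat p * x + c \<or> of_nat p * x + c < 0" if "x \<in> G" for x
  proof -
    have "of_nat p * x + c \<noteq> 0"
      using c(2)[OF uminus_mem[OF that]] by (simp add: add_eq_0_iff)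
    then show ?thesis by linarith
  qed
  then have "K0_eq \<M> (frag_of whole) (frag_of (half_line p c) + frag_of ?N)"
    using definable_half_line[OF c(1)] N unfolding half_line_def
    by (intro K0_eq_line_union) auto
  also have "K0_eq \<M> \<dots> (frag_of (half_line p c) + frag_of (half_line p (- c)))"
  proof (intro K0_eq_add K0_eq_refl)
    show "K0_eq \<M> (frag_of ?N) (frag_of (half_line p (- c)))"
      unfolding half_line_def
    proof (rule K0_eq_line_iso[where R = "\<lambda>x y. x + y = 0" and h = uminus and k = uminus, OF N])
      show "definable_pred \<M> 2 (\<lambda>v. v ! 0 + v ! 1 = 0)"
        by (intro definable_intros) auto
      show "line (\<lambda>x. 0 < of_nat p * x + - c) \<in> definable_sets \<M> 1"
        using definable_half_line[OF uminus_mem[OF c(1)]] unfolding half_line_def .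
    qed (auto intro: uminus_mem)
  qed
  finally show ?thesis .
qed

text \<open>
  When \<open>G\<close> is \<open>2\<close>-divisible, doubling is a definable automorphism of the ordered group. It doubles the
  endpoints of half-lines.
\<close>

lemma half_line_double:
  assumes c: "c \<in> G" and "p_divisible 2 G"
  shows "K0_eq \<M> (frag_of (half_line p c)) (frag_of (half_line p (of_nat 2 * c)))"
  unfolding half_line_def
proof (rule K0_eq_line_iso[where R = "\<lambda>x y. y = of_nat 2 * x" and h = "\<lambda>x. 2 * x" and k = "\<lambda>y. y / 2"])
  show "definable_pred \<M> 2 (\<lambda>v. v ! 1 = of_nat 2 * v ! 0)"
    by (intro definable_intros) auto
  show "line (\<lambda>x. 0 < of_nat p * x + c) \<in> definable_sets \<M> 1"
    "line (\<lambda>x. 0 < of_nat p * x + of_nat 2 * c) \<in> definable_sets \<M> 1"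
    using definable_half_line[OF c] definable_half_line[OF of_nat_mult_mem[OF c, of 2]]
    unfolding half_line_def by blast+
  fix x assume "x \<in> G" "0 < of_nat p * x + c"
  then show "2 * x \<in> G \<and> 0 < of_nat p * (2 * x) + of_nat 2 * c \<and> (2 * x) / 2 = x"
    using of_nat_mult_mem[of x 2] by (simp add: algebra_simps)
next
  fix y assume y: "y \<in> G" "0 < of_nat p * y + of_nat 2 * c"
  obtain z where "z \<in> G" "2 * z = y"
    using assms(2) y(1) unfolding p_divisible_def by auto
  then show "y / 2 \<in> G \<and> 0 < of_nat p * (y / 2) + c \<and> 2 * (y / 2) = y"
    using y(2) by auto
qed auto

lemma half_line_double_power:
  assumes "c \<in> G" "p_divisible 2 G"
  shows "K0_eq \<M> (frag_of (half_line p c)) (frag_of (half_line p (of_nat (2 ^ n) * c)))"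
proof (induction n)
  case (Suc n)
  also have "K0_eq \<M> (frag_of (half_line p (of_nat (2 ^ n) * c)))
      (frag_of (half_line p (of_nat 2 * (of_nat (2 ^ n) * c))))"
    using assms by (intro half_line_double of_nat_mult_mem)
  finally show ?case by (simp add: mult.assoc)
qed simp

text \<open>
  Multiplication by \<open>p\<close> followed by translation by \<open>c\<close> is a definable bijection from a half-line
  to the positive part of the coset \<open>c + pG\<close>.
\<close>

lemma half_line_coset:
  fixes p :: nat
  assumes "p > 0" "c \<in> G"
  defines "C \<equiv> \<lambda>x. 0 < x \<and> (\<exists>y\<in>G. x = of_nat p * y + c)"
  shows "line C \<in> definable_sets \<M> 1" and "K0_eq \<M> (frag_of (half_line p c)) (frag_of (line C))"
proof -
  have "definable_pred \<M> (Suc 1) (\<lambda>v. v ! 0 = of_nat p * v ! 1 + c)"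
    using assms by (intro definable_intros) auto
  from definable_pred_ex[OF this]
  have "definable_pred \<M> 1 (\<lambda>v. \<exists>y\<in>G. v ! 0 = of_nat p * y + c)"
    by (rule definable_pred_cong) (auto simp: tuples_1[unfolded One_nat_def])
  then have "definable_pred \<M> 1 (\<lambda>v. 0 < v ! 0 \<and> (\<exists>y\<in>G. v ! 0 = of_nat p * y + c))"
    by (intro definable_intros) auto
  then show def: "line C \<in> definable_sets \<M> 1"
    unfolding C_def by (rule definable_line)
  show "K0_eq \<M> (frag_of (half_line p c)) (frag_of (line C))"
    unfolding half_line_def
  proof (rule K0_eq_line_iso[where R = "\<lambda>x y. y = of_nat p * x + c" and
        h = "\<lambda>x. of_nat p * x + c" and k = "\<lambda>y. (y - c) / of_nat p", OF _ def])
    show "line (\<lambda>x. 0 < of_nat p * x + c) \<in> definable_sets \<M> 1"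
      using definable_half_line assms unfolding half_line_def by blast
    show "definable_pred \<M> 2 (\<lambda>v. v ! 1 = of_nat p * v ! 0 + c)"
      using assms by (intro definable_intros) auto
    fix x assume "x \<in> G" "0 < of_nat p * x + c"
    then show "of_nat p * x + c \<in> G \<and> C (of_nat p * x + c) \<and> ((of_nat p * x + c) - c) / of_nat p = x"
      using assms by (auto simp: C_def intro: add_mem of_nat_mult_mem)
  next
    fix y assume "y \<in> G" "C y"
    then show "(y - c) / of_nat p \<in> G \<and> 0 < of_nat p * ((y - c) / of_nat p) + c \<and>
        of_nat p * ((y - c) / of_nat p) + c = y"
      using assms by (auto simp: C_def)
  qed auto
qed

text \<open>
  The positive elements split into their intersections with the \<open>p\<close> cosets of \<open>p G\<close>, and each
  piece is definably isomorphic to a half-line. The piece for \<open>j = 0\<close> has the class of the positive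
  elements themselves, so the other pieces sum up to zero.
\<close>

lemma half_line_sum:
  fixes p :: nat
  assumes p: "Factorial_Ring.prime p" and r: "r \<in> G" "\<And>y. y \<in> G \<Longrightarrow> of_nat p * y \<noteq> r"
  shows "K0_eq \<M> (\<Sum>j=1..<p. frag_of (half_line p (of_nat j * r))) 0"
proof -
  define C where "C j = line (\<lambda>x. 0 < x \<and> (\<exists>y\<in>G. x = of_nat p * y + of_nat j * r))" for j :: nat
  let ?H = "\<lambda>j :: nat. frag_of (half_line p (of_nat j * r))"
  have p0: "p > 0" using p by (rule prime_gt_0_nat)
  have jr: "of_nat j * r \<in> G" for j using r(1) by (rule of_nat_mult_mem)
  have union: "positives = (\<Union>j<p. C j)"
    using cosets_exhaust[OF p r] unfolding C_def line_eq by blast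
  have "K0_eq \<M> (frag_of (\<Union>j<p. C j)) (\<Sum>j<p. frag_of (C j))"
  proof (rule K0_eq_UNION[where n = 1])
    show "universe \<M> \<noteq> {}" by (rule universe_nonempty)
    show "C j \<in> definable_sets \<M> 1" for j
      unfolding C_def using half_line_coset(1)[OF p0 jr] .
    fix i j :: nat assume ij: "i < j" "j < p"
    show "C i \<inter> C j = {}"
    proof (rule ccontr)
      assume "C i \<inter> C j \<noteq> {}"
      then obtain y z where yz: "y \<in> G" "z \<in> G" "of_nat p * y + of_nat i * r = of_nat p * z + of_nat j * r"
        unfolding C_def line_eq by auto
      then have eq: "of_int (int p) * (y - z) = of_int (int j - int i) * r"
        by (simp add: algebra_simps)
      have "\<not> int p dvd int j - int i"
        using ij by (auto dest: zdvd_imp_le)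
      moreover have "Factorial_Ring.prime (int p)" using p by simp
      ultimately have "coprime (int j - int i) (int p)"
        by (metis coprime_commute prime_imp_coprime)
      with eq obtain w where "w \<in> G" "of_int (int p) * w = r"
        using divides_if_coprime_multiple[of "int j - int i" "int p" r "y - z"] p0 r(1) yz
        by (auto intro: diff_mem)
      then show False using r(2) by simp
    qed
  qed
  also have "K0_eq \<M> \<dots> (\<Sum>j<p. ?H j)"
    unfolding C_def by (intro K0_eq_sum K0_eq_sym[OF half_line_coset(2)[OF p0 jr]])
  also have "(\<Sum>j<p. ?H j) = ?H 0 + (\<Sum>j=1..<p. ?H j)"
    using p0 by (simp add: lessThan_atLeast0 sum.atLeast_Suc_lessThan)
  also have "half_line p (of_nat 0 * r) = positives"
    using p0 by (simp add: half_line_def line_eq zero_less_mult_iff)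
  finally have "K0_eq \<M> (frag_of positives) (frag_of positives + (\<Sum>j=1..<p. ?H j))"
    unfolding union .
  then show ?thesis by (rule K0_eq_cancel)
qed

text \<open>
  For \<open>p = 2\<close> the sum of half-lines has a single summand \<open>[H]\<close>, so \<open>[H] = 0\<close>. As \<open>r\<close> and \<open>- r\<close> are
  congruent modulo \<open>2 G\<close>, the complement of \<open>H\<close> has the same class, whence \<open>[G] = 0\<close>.
\<close>

lemma trivial_if_not_2_divisible:
  assumes "\<not> p_divisible 2 G"
  shows "K0_eq \<M> (frag_of {[]}) 0"
proof -
  obtain r where r: "r \<in> G" "\<And>y. y \<in> G \<Longrightarrow> of_nat 2 * y \<noteq> r"
    using assms unfolding p_divisible_def by auto
  let ?h = "frag_of (half_line 2 r)"
  have "{1..<2 :: nat} = {1}" by auto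
  then have zero: "K0_eq \<M> ?h 0"
    using half_line_sum[OF two_is_prime_nat r] by simp
  have "K0_eq \<M> (frag_of whole) (?h + frag_of (half_line 2 (- r)))"
    using r by (rule half_line_complement)
  also have "K0_eq \<M> \<dots> (?h + frag_of (half_line 2 (- r + of_nat 2 * r)))"
    by (intro K0_eq_add K0_eq_refl half_line_translate uminus_mem r)
  also have "- r + of_nat 2 * r = r" by simp
  also have "K0_eq \<M> (?h + ?h) (0 + 0)"
    by (intro K0_eq_add zero)
  finally have "K0_eq \<M> (frag_cmul 1 (frag_of whole)) 0" by simp
  from unit_torsion[OF this] show ?thesis by simp
qed

text \<open>
  The endpoints \<open>- j r / p\<close> and \<open>- (p - j) r / p\<close> are opposite modulo \<open>G\<close>.
\<close>

lemma half_line_reflect: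
  assumes "r \<in> G" "\<And>y. y \<in> G \<Longrightarrow> of_nat p * y \<noteq> of_nat j * r" "j \<le> p"
  shows "K0_eq \<M> (frag_of (half_line p (of_nat j * r)) + frag_of (half_line p (of_nat (p - j) * r)))
           (frag_of whole)"
proof -
  have "K0_eq \<M> (frag_of whole)
      (frag_of (half_line p (of_nat j * r)) + frag_of (half_line p (- (of_nat j * r))))"
    using assms by (intro half_line_complement of_nat_mult_mem)
  also have "K0_eq \<M> \<dots> (frag_of (half_line p (of_nat j * r)) +
      frag_of (half_line p (- (of_nat j * r) + of_nat p * r)))"
    using assms by (intro K0_eq_add K0_eq_refl half_line_translate uminus_mem of_nat_mult_mem)
  also have "- (of_nat j * r) + of_nat p * r = of_nat (p - j) * r"
    using assms(3) by (simp add: of_nat_diff algebra_simps)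
  finally show ?thesis by (rule K0_eq_sym)
qed

text \<open>
  Pairing \<open>j\<close> with \<open>p - j\<close> in the vanishing sum of half-lines gives \<open>(p - 1) / 2\<close> pairs, each of
  class \<open>[G]\<close>. Hence the integer \<open>(p - 1) / 2\<close> is zero in the Grothendieck ring.
\<close>

lemma half_of_predecessor_vanishes:
  fixes m :: nat
  assumes p: "Factorial_Ring.prime (2 * m + 1)" and "\<not> p_divisible (2 * m + 1) G"
  shows "K0_eq \<M> (frag_cmul (int m) (frag_of {[]})) 0"
proof -
  let ?p = "2 * m + 1"
  obtain r where r: "r \<in> G" "\<And>y. y \<in> G \<Longrightarrow> of_nat ?p * y \<noteq> r"
    using assms(2) unfolding p_divisible_def by blast
  let ?H = "\<lambda>j :: nat. frag_of (half_line ?p (of_nat j * r))"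
  have multiple: "of_nat ?p * y \<noteq> of_nat j * r" if j: "1 \<le> j" "j \<le> m" and y: "y \<in> G" for j y
  proof
    assume eq: "of_nat ?p * y = of_nat j * r"
    have "\<not> int ?p dvd int j" using j by (auto dest: zdvd_imp_le)
    moreover have "Factorial_Ring.prime (int ?p)" using p by (simp only: prime_nat_int_transfer)
    ultimately have "coprime (int j) (int ?p)"
      by (metis coprime_commute prime_imp_coprime)
    moreover have "of_int (int ?p) * y = of_int (int j) * r" using eq by simp
    ultimately obtain w where "w \<in> G" "of_int (int ?p) * w = r"
      using divides_if_coprime_multiple[of "int j" "int ?p" r y] r(1) y by auto
    then show False using r(2)[of w] by simp
  qed
  have "(\<Sum>j=1..<?p. ?H j) = (\<Sum>j=1..m. ?H j) + (\<Sum>j=m + 1..2 * m. ?H j)"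
    using sum.ub_add_nat[of 1 m ?H m] by (simp add: mult_2 atLeastLessThanSuc_atLeastAtMost)
  also have "(\<Sum>j=m + 1..2 * m. ?H j) = (\<Sum>j=1..m. ?H (?p - j))"
    by (rule sum.reindex_bij_witness[of _ "\<lambda>j. ?p - j" "\<lambda>j. ?p - j"]) auto
  finally have "(\<Sum>j=1..<?p. ?H j) = (\<Sum>j=1..m. ?H j + ?H (?p - j))"
    by (simp add: sum.distrib)
  moreover have "K0_eq \<M> (\<Sum>j=1..m. ?H j + ?H (?p - j)) (\<Sum>j=1..m. frag_of whole)"
    by (intro K0_eq_sum half_line_reflect r multiple) auto
  moreover have "(\<Sum>j=1..m. frag_of whole) = frag_cmul (int m) (frag_of whole)"
    by (induction m) (simp_all add: frag_cmul_distrib add.commute)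
  ultimately have "K0_eq \<M> (frag_cmul (int m) (frag_of whole)) 0"
    using K0_eq_trans[OF K0_eq_sym half_line_sum[OF p r]] by simp
  then show ?thesis by (rule unit_torsion)
qed

text \<open>
  Let \<open>G\<close> be \<open>2\<close>-divisible. Doubling \<open>n + 1\<close> times takes \<open>r\<close> to \<open>(p - 1) r\<close>, which is \<open>- r\<close> modulo \<open>p G\<close>, so
  a half-line \<open>H\<close> and its complement have equal classes and \<open>[G] = 2 [H]\<close>. As \<open>[G]\<close> is invertible, so
  is \<open>2\<close>; but \<open>2\<^sup>n = (p - 1) / 2\<close> is zero.
\<close>

lemma trivial_if_not_fermat_divisible:
  assumes p: "Factorial_Ring.prime (2 ^ Suc n + 1 :: nat)" and "\<not> p_divisible (2 ^ Suc n + 1) G"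
  shows "K0_eq \<M> (frag_of {[]}) 0"
proof (cases "p_divisible 2 G")
  case False
  then show ?thesis by (rule trivial_if_not_2_divisible)
next
  case True
  let ?p = "2 ^ Suc n + 1 :: nat" and ?u = "frag_of {[] :: rat list}"
  obtain r where r: "r \<in> G" "\<And>y. y \<in> G \<Longrightarrow> of_nat ?p * y \<noteq> r"
    using assms(2) unfolding p_divisible_def by blast
  let ?H = "half_line ?p r"
  have "K0_eq \<M> (frag_of whole) (frag_of ?H + frag_of (half_line ?p (of_nat (?p - 1) * r)))"
    using K0_eq_sym[OF half_line_reflect[of r ?p 1]] r by simp
  also have "K0_eq \<M> \<dots> (frag_of ?H + frag_of ?H)"
    using K0_eq_sym[OF half_line_double_power[OF r(1) True, of ?p "Suc n"]]
    by (intro K0_eq_add K0_eq_refl) simp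
  also have "frag_of ?H + frag_of ?H = frag_cmul 2 (frag_of ?H)"
    using frag_cmul_distrib[of 1 1 "frag_of ?H"] by simp
  finally have "K0_eq \<M> (frag_of whole) (frag_cmul 2 (frag_of ?H))" .
  from K0_eq_times_class[OF this definable_whole]
  have "K0_eq \<M> (frag_of (list_times whole whole)) (frag_cmul 2 (frag_of (list_times whole ?H)))"
    by (simp add: times_class_cmul)
  with K0_eq_sym[OF whole_square] have half: "K0_eq \<M> ?u (frag_cmul 2 (frag_of (list_times whole ?H)))"
    by (rule K0_eq_trans)
  have "K0_eq \<M> (frag_cmul (2 ^ k) ?u) 0 \<Longrightarrow> K0_eq \<M> ?u 0" for k :: nat
  proof (induction k)
    case (Suc k)
    have "K0_eq \<M> (frag_cmul (2 ^ k) ?u) (frag_cmul (2 ^ k) (frag_cmul 2 (frag_of (list_times whole ?H))))"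
      by (intro K0_eq_cmul half)
    also have "\<dots> = times_class (list_times whole ?H) (frag_cmul (2 ^ Suc k) ?u)"
      by (simp add: times_class_cmul mult.commute)
    also have "K0_eq \<M> \<dots> (times_class (list_times whole ?H) 0)"
      by (rule K0_eq_times_class[OF Suc.prems
            definable_sets_list_times[OF definable_whole definable_half_line[OF r(1)]]])
    finally show ?case using Suc.IH by simp
  qed simp
  moreover have "K0_eq \<M> (frag_cmul (2 ^ n) ?u) 0"
    using half_of_predecessor_vanishes[of "2 ^ n"] assms by simp
  ultimately show ?thesis by blast
qed

end

section \<open>Finitely many divisible primes\<close>

lemma cong_1_if_prime_factors_cong_1:
  fixes N m :: nat
  assumes "N > 0" "\<And>p. Factorial_Ring.prime p \<Longrightarrow> p dvd N \<Longrightarrow> p mod m = 1 mod m"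
  shows "N mod m = 1 mod m"
  using assms
proof (induction N rule: prime_divisors_induct)
  case (factor p x)
  then have "p mod m = 1 mod m" "x mod m = 1 mod m" by (auto simp: dvd_mult)
  then show ?case by (metis mod_mult_eq mult_1)
qed auto

text \<open>
  Euclid's argument, applied to \<open>m P - 1\<close> where \<open>P\<close> is the product of the excluded numbers: this
  number is \<open>- 1\<close> modulo \<open>m\<close>, so not all its prime factors can be \<open>1\<close> modulo \<open>m\<close>, and none of them
  divides \<open>P\<close>. As \<open>m\<close> is even, they are all odd.
\<close>

lemma prime_not_cong_1_outside_finite:
  fixes m :: nat
  assumes "finite S" "m > 2" "even m"
  obtains p :: nat where "Factorial_Ring.prime p" "p \<notin> S" "odd p" "p mod m \<noteq> 1"
proof -
  \<comment> \<open>zero is left out so that the product is positive\<close>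
  define P where "P = (\<Prod>q\<in>S - {0}. q)"
  have "P > 0" unfolding P_def using assms(1) by (intro prod_pos) auto
  then have mP: "m * P \<ge> m" by simp
  define N where "N = m * P - 1"
  have N: "Suc N = m * P" "N > 0" using mP assms(2) unfolding N_def by linarith+
  have "N mod m \<noteq> 1 mod m"
  proof
    assume "N mod m = 1 mod m"
    then have "Suc N mod m = 2 mod m" by (metis mod_Suc_eq numeral_2_eq_2 One_nat_def)
    then show False using N assms(2) by simp
  qed
  with N(2) obtain p where p: "Factorial_Ring.prime p" "p dvd N" "p mod m \<noteq> 1 mod m"
    using cong_1_if_prime_factors_cong_1 by blast
  have not_dvd: "\<not> p dvd m * P"
  proof
    assume "p dvd m * P"
    then have "p dvd Suc N - N" using p(2) N by (metis dvd_diff_nat)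
    then show False using p(1) by simp
  qed
  have "p \<notin> S"
  proof
    assume "p \<in> S"
    then have "p dvd P" unfolding P_def using assms(1) p(1) by (intro dvd_prodI) auto
    then show False using not_dvd by simp
  qed
  moreover have "p \<noteq> 2" using not_dvd assms(3) by auto
  then have "odd p" using p(1) primes_dvd_imp_eq two_is_prime_nat by blast
  ultimately show thesis using that p assms(2) by simp
qed

context rat_subgroup
begin

text \<open>
  Let \<open>d\<close> be the characteristic of the Grothendieck ring; it is positive. It divides \<open>(p - 1) / 2\<close> for
  every odd prime \<open>p\<close> for which \<open>G\<close> is not \<open>p\<close>-divisible. With finitely many exceptions all
  primes would then be \<open>1\<close> modulo \<open>2 d\<close>, which is absurd unless \<open>d = 1\<close>.
\<close>

lemma trivial_if_finitely_many_divisible_primes: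
  assumes "finite (divisible_primes G)"
  shows "K0_eq \<M> (frag_of {[]}) 0"
proof -
  let ?u = "frag_of {[] :: rat list}"
  define vanishes where "vanishes d \<longleftrightarrow> K0_eq \<M> (frag_cmul (int d) ?u) 0" for d :: nat
  have vanishes_prime: "vanishes (p div 2)"
    if "Factorial_Ring.prime p" "p \<notin> divisible_primes G" "odd p" for p
  proof -
    have "p = 2 * (p div 2) + 1" using that(3) by simp
    then show ?thesis
      using half_of_predecessor_vanishes[of "p div 2"] that
      unfolding divisible_primes_def vanishes_def by auto
  qed
  \<comment> \<open>any odd prime outside the finite set will do, so the modulus is arbitrary\<close>
  obtain q where "Factorial_Ring.prime q" "q \<notin> divisible_primes G" "odd q"
    using prime_not_cong_1_outside_finite[OF assms, of 4] by auto
  then have "vanishes (q div 2)" "q div 2 > 0"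
    using vanishes_prime prime_gt_1_nat[of q] by (auto elim: oddE)
  then have ex: "\<exists>d. d > 0 \<and> vanishes d" by blast
  define d where "d = (LEAST d. d > 0 \<and> vanishes d)"
  have d: "d > 0" "vanishes d" and least: "\<And>e. e > 0 \<Longrightarrow> vanishes e \<Longrightarrow> d \<le> e"
    using LeastI_ex[OF ex] Least_le[of "\<lambda>d. d > 0 \<and> vanishes d"] unfolding d_def by auto
  \<comment> \<open>the integers that vanish are closed under remainders\<close>
  have dvd: "d dvd e" if "vanishes e" for e
  proof -
    have "K0_eq \<M> (frag_cmul (int e) ?u - frag_cmul (int (e div d)) (frag_cmul (int d) ?u))
        (0 - frag_cmul (int (e div d)) 0)"
      using that d(2) unfolding vanishes_def by (intro K0_eq_diff K0_eq_cmul)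
    moreover have "int e - int (e div d) * int d = int (e mod d)"
      by (metis minus_div_mult_eq_mod of_nat_mult zdiv_int zmod_int)
    ultimately have "vanishes (e mod d)"
      unfolding vanishes_def by (simp flip: frag_cmul_diff_distrib)
    then have "e mod d = 0" using least[of "e mod d"] d(1) by (metis gr_zeroI leD mod_less_divisor)
    then show ?thesis by presburger
  qed
  have "d = 1"
  proof (rule ccontr)
    assume "d \<noteq> 1"
    then have "2 * d > 2" using d(1) by simp
    then obtain p where p: "Factorial_Ring.prime p" "p \<notin> divisible_primes G" "odd p" "p mod (2 * d) \<noteq> 1"
      using prime_not_cong_1_outside_finite[OF assms, of "2 * d"] by auto
    then have "d dvd p div 2" using vanishes_prime dvd by blast
    then obtain k where "p div 2 = d * k" by (rule dvdE)
    then have "p = 2 * d * k + 1" using p(3) by (metis mult.assoc odd_two_times_div_two_succ)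
    then have "p mod (2 * d) = 1 mod (2 * d)" by (metis add.commute mod_mult_self2)
    then show False using p(4) \<open>2 * d > 2\<close> by simp
  qed
  then show ?thesis using d(2) unfolding vanishes_def by simp
qed

end

theorem corollary2p7:
  fixes G :: "rat set"
  assumes "subgroup G rat_group"
    and "G \<noteq> UNIV"
    and "finite (divisible_primes G) \<or>
         (\<exists>(n::nat) p::nat. p = 2 ^ n + 1 \<and> Factorial_Ring.prime p \<and> p \<notin> divisible_primes G)"
  shows "trivial_ring (Grothendieck_ring (ordered_group_struct G))"
proof -
  have "group rat_group"
    by (rule groupI) (auto simp: rat_group_def intro: exI[of _ "- x" for x :: rat])
  then interpret group rat_group .
  interpret rat_subgroup G
  proof
    show "0 \<in> G" "x \<in> G \<Longrightarrow> y \<in> G \<Longrightarrow> x + y \<in> G" for x y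
      using subgroup.one_closed[OF assms(1)] subgroup.m_closed[OF assms(1)]
      by (auto simp: rat_group_def)
    fix x assume "x \<in> G"
    moreover have "inv\<^bsub>rat_group\<^esub> x = - x"
      by (rule inv_equality) (auto simp: rat_group_def)
    ultimately show "- x \<in> G"
      using subgroup.m_inv_closed[OF assms(1)] by metis
  qed
  have "K0_eq (ordered_group_struct G) (frag_of {[]}) 0"
    using assms(3)
  proof (elim disjE exE conjE)
    assume "finite (divisible_primes G)"
    then show ?thesis by (rule trivial_if_finitely_many_divisible_primes)
  next
    fix n p :: nat
    assume p: "p = 2 ^ n + 1" "Factorial_Ring.prime p" "p \<notin> divisible_primes G"
    then have "\<not> p_divisible p G" by (simp add: divisible_primes_def)
    with p show ?thesis
      by (cases n) (auto intro: trivial_if_not_2_divisible trivial_if_not_fermat_divisible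
          simp: numeral_2_eq_2)
  qed
  then show ?thesis by (rule trivial_ring_if_unit_vanishes)
qed

end
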